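(* Assume that $\partial \Omega$ is Lipschitz whenever it is nonempty, and that the following two properties hold: \begin{itemize} \item (Quantum Unique Ergodicity on the base, QUE) the whole sequence of probability measures $\mu_j=\phi_j^2\,dV_g$ converges vaguely to the uniform measure $\frac{1}{V_g(\Omega)}\,dV_g$; \item (uniform $L^p$-boundedness) there exist $p\in(1,+\infty]$ and $A_0>0$ such that $\|\phi_j\|_{L^{2p}(\Omega)}\le A_0$ for every $j\in\mathbb{N}^*$. \end{itemize} Then $$\sup_{\chi_\omega\in \mathcal{U}_L^b} \inf_{j\in \mathbb{N}^*}\int_{\omega} \phi_j(x)^2\, dV_g = L$$ for every $L\in (0,1)$.
   Context: Setting. $(M,g)$ is a smooth $n$-dimensional Riemannian manifold ($n\ge 1$), $\Omega$ is a bounded connected open subset of $M$ (the case $\partial\Omega=\emptyset$ is allowed; then $\Omega$ is a compact connected Riemannian manifold), and $V_g$ is the Riemannian volume measure; measurability is with respect to $V_g$. If $\partial\Omega\ne\emptyset$, one of the following boundary conditions $By=0$ on $\partial\Omega$ is fixed: Dirichlet ($By=y_{|\partial\Omega}$); Neumann ($By=\frac{\partial y}{\partial n}_{|\partial\Omega}$); mixed Dirichlet-Neumann ($By=\chi_{\Gamma_0}y_{|\partial\Omega}+\chi_{\Gamma_1}\frac{\partial y}{\partial n}_{|\partial\Omega}$ with $\partial\Omega=\Gamma_0\cup\Gamma_1$, $\Gamma_0\cap\Gamma_1=\emptyset$); Robin ($By=\frac{\partial y}{\partial n}_{|\partial\Omega}+\beta y_{|\partial\Omega}$, with $\beta\ge0$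 bounded measurable on $\partial\Omega$, $\int_{\partial\Omega}\beta>0$). $X=\{y\in L^2(\Omega,\mathbb{C}) : \int_\Omega y\,dV_g=0\}$ in the Neumann and boundaryless cases, and $X=L^2(\Omega,\mathbb{C})$ otherwise. $A=-\triangle_g$ with domain $D(A)=\{y\in X : Ay\in X,\ By=0\}$ is a positive selfadjoint operator. $(\phi_j)_{j\in\mathbb{N}^*}$ is a fixed orthonormal Hilbertian basis of $X$ of real-valued eigenfunctions of $A$, with $A\phi_j=\lambda_j^2\phi_j$, $\lambda_j>0$, listed in nondecreasing order. $\chi_\omega$ is the characteristic function of $\omega$. $\mathcal{U}_L^b=\{\chi_\omega : \omega\subset\Omega \text{ measurable},\ V_g(\omega)=LV_g(\Omega),\ V_g(\partial\omega)=0\}$. Vague convergence of measures means convergence when tested against continuous compactly supported functions. *)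

theory Defs
  imports "HOL-Probability.Probability"
begin

section \<open>Smooth manifolds\<close>

definition pderiv_at :: "'n \<Rightarrow> (real^'n \<Rightarrow> 'b::real_normed_vector) \<Rightarrow> real^'n \<Rightarrow> 'b" where
  "pderiv_at i f x = frechet_derivative f (at x) (axis i 1)"

text \<open>The next two predicates are meant for open sets \<open>S\<close>, on which \<open>at x\<close> and
  \<open>at x within S\<close> agree.\<close>

primrec Ck_on :: "nat \<Rightarrow> (real^'n) set \<Rightarrow> (real^'n \<Rightarrow> 'b::real_normed_vector) \<Rightarrow> bool" where
  "Ck_on 0 S f \<longleftrightarrow> continuous_on S f"
| "Ck_on (Suc k) S f \<longleftrightarrow> f differentiable_on S \<and> (\<forall>i. Ck_on k S (pderiv_at i f))"

definition smooth_on :: "(real^'n) set \<Rightarrow> (real^'n \<Rightarrow> 'b::real_normed_vector) \<Rightarrow> bool" where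
  "smooth_on S f \<longleftrightarrow> (\<forall>k. Ck_on k S f)"

text \<open>The manifold is the whole type \<open>'m\<close>, of class Hausdorff and second countable, and its
  dimension is \<open>CARD('n)\<close>. A chart is a domain with a coordinate map; the values of the
  coordinate map outside the domain are irrelevant.\<close>

type_synonym ('m, 'n) chart = "'m set \<times> ('m \<Rightarrow> real^'n)"

abbreviation cdom :: "('m, 'n::finite) chart \<Rightarrow> 'm set" where
  "cdom c \<equiv> fst c"

abbreviation coord :: "('m, 'n::finite) chart \<Rightarrow> 'm \<Rightarrow> real^'n" where
  "coord c \<equiv> snd c"

definition param :: "('m, 'n::finite) chart \<Rightarrow> real^'n \<Rightarrow> 'm" where
  "param c = inv_into (cdom c) (coord c)"

definition is_chart :: "('m::topological_space, 'n::finite) chart \<Rightarrow> bool" where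
  "is_chart c \<longleftrightarrow> open (cdom c) \<and> open (coord c ` cdom c) \<and>
     homeomorphism (cdom c) (coord c ` cdom c) (coord c) (param c)"

definition transition ::
  "('m, 'n::finite) chart \<Rightarrow> ('m, 'n) chart \<Rightarrow> real^'n \<Rightarrow> real^'n" where
  "transition c d = coord d \<circ> param c"

definition compatible :: "('m, 'n::finite) chart \<Rightarrow> ('m, 'n) chart \<Rightarrow> bool" where
  "compatible c d \<longleftrightarrow>
     smooth_on (coord c ` (cdom c \<inter> cdom d)) (transition c d) \<and>
     smooth_on (coord d ` (cdom c \<inter> cdom d)) (transition d c)"

definition smooth_structure ::
  "('m::{t2_space, second_countable_topology}, 'n::finite) chart set \<Rightarrow> bool" where
  "smooth_structure \<A> \<longleftrightarrow>
     (\<forall>c\<in>\<A>. is_chart c) \<and> (\<Union>c\<in>\<A>. cdom c) = UNIV \<and> (\<forall>c\<in>\<A>. \<forall>d\<in>\<A>. compatible c d) \<and>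
     (\<forall>c. is_chart c \<and> (\<forall>d\<in>\<A>. compatible c d) \<longrightarrow> c \<in> \<A>)"

definition smooth_fun ::
  "('m, 'n::finite) chart set \<Rightarrow> ('m \<Rightarrow> 'b::real_normed_vector) \<Rightarrow> bool" where
  "smooth_fun \<A> f \<longleftrightarrow> (\<forall>c\<in>\<A>. smooth_on (coord c ` cdom c) (f \<circ> param c))"

text \<open>Some chart around a point. It is used only to evaluate expressions that are invariant
  under change of chart at that point.\<close>

definition chart_at :: "('m, 'n::finite) chart set \<Rightarrow> 'm \<Rightarrow> ('m, 'n) chart" where
  "chart_at \<A> p = (SOME c. c \<in> \<A> \<and> p \<in> cdom c)"


section \<open>Riemannian metrics\<close>

text \<open>A metric is given by its component matrices \<open>g c p\<close> in each chart \<open>c\<close> at the points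
  \<open>p\<close> of its domain, subject to the transformation law of covariant 2-tensors.\<close>

type_synonym ('m, 'n) metric = "('m, 'n) chart \<Rightarrow> 'm \<Rightarrow> real^'n^'n"

definition riemannian_metric :: "('m, 'n::finite) chart set \<Rightarrow> ('m, 'n) metric \<Rightarrow> bool" where
  "riemannian_metric \<A> g \<longleftrightarrow>
     (\<forall>c\<in>\<A>. smooth_on (coord c ` cdom c) (g c \<circ> param c)) \<and>
     (\<forall>c\<in>\<A>. \<forall>p\<in>cdom c. transpose (g c p) = g c p \<and> (\<forall>v. v \<noteq> 0 \<longrightarrow> 0 < v \<bullet> (g c p *v v))) \<and>
     (\<forall>c\<in>\<A>. \<forall>d\<in>\<A>. \<forall>p\<in>cdom c \<inter> cdom d.
        (let D = jacobian (transition c d) (at (coord c p))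
         in g c p = transpose D ** g d p ** D))"

text \<open>\<open>joined \<A> g p q l\<close>: some piecewise continuously differentiable curve of length \<open>l\<close> leads
  from \<open>p\<close> to \<open>q\<close>. By compactness of the parameter interval such a curve is a finite
  concatenation of pieces each of which runs inside one chart.\<close>

inductive joined ::
  "('m, 'n::finite) chart set \<Rightarrow> ('m, 'n) metric \<Rightarrow> 'm \<Rightarrow> 'm \<Rightarrow> real \<Rightarrow> bool" for \<A> g where
  refl: "joined \<A> g p p 0"
| step: "joined \<A> g p q l \<Longrightarrow> c \<in> \<A> \<Longrightarrow> \<gamma> C1_differentiable_on {0..1} \<Longrightarrow>
    \<gamma> ` {0..1} \<subseteq> coord c ` cdom c \<Longrightarrow> param c (\<gamma> 0) = q \<Longrightarrow> param c (\<gamma> 1) = r \<Longrightarrow>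
    joined \<A> g p r
      (l + integral {0..1} (\<lambda>t. let v = vector_derivative \<gamma> (at t)
                                in sqrt (v \<bullet> (g c (param c (\<gamma> t)) *v v))))"

definition riem_dist ::
  "('m, 'n::finite) chart set \<Rightarrow> ('m, 'n) metric \<Rightarrow> 'm \<Rightarrow> 'm \<Rightarrow> ennreal" where
  "riem_dist \<A> g p q = (INF l\<in>{l. joined \<A> g p q l}. ennreal l)"

definition riem_bounded ::
  "('m, 'n::finite) chart set \<Rightarrow> ('m, 'n) metric \<Rightarrow> 'm set \<Rightarrow> bool" where
  "riem_bounded \<A> g S \<longleftrightarrow> (\<exists>C::real. \<forall>p\<in>S. \<forall>q\<in>S. riem_dist \<A> g p q \<le> ennreal C)"

text \<open>The Riemannian volume, completed, so that \<open>sets V\<close> are the measurable sets in the sense of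
  Lebesgue.\<close>

definition riemannian_volume ::
  "('m::topological_space, 'n::finite) chart set \<Rightarrow> ('m, 'n) metric \<Rightarrow> 'm measure \<Rightarrow> bool" where
  "riemannian_volume \<A> g V \<longleftrightarrow> (\<exists>B. sets B = sets borel \<and> V = completion B \<and>
     (\<forall>c\<in>\<A>. \<forall>E\<in>sets borel. E \<subseteq> cdom c \<longrightarrow>
        emeasure B E =
          (\<integral>\<^sup>+x. indicator (coord c ` E) x * ennreal (sqrt (det (g c (param c x)))) \<partial>lborel)))"


section \<open>Lipschitz boundaries and the induced boundary measure\<close>

text \<open>In the chart \<open>c\<close>, the set \<open>\<Omega>\<close> is the part above the graph of a Lipschitz function \<open>h\<close>
  of the coordinates other than \<open>i\<close>. Rotated and restricted charts belong to the maximal atlas,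
  so no further change of coordinates is needed.\<close>

definition lipschitz_graph_chart ::
  "('m, 'n::finite) chart set \<Rightarrow> 'm set \<Rightarrow> ('m, 'n) chart \<Rightarrow> 'n \<Rightarrow> (real^'n \<Rightarrow> real) \<Rightarrow> bool" where
  "lipschitz_graph_chart \<A> \<Omega> c i h \<longleftrightarrow> c \<in> \<A> \<and> (\<exists>K. K-lipschitz_on UNIV h) \<and>
     (\<forall>x y. (\<forall>j. j \<noteq> i \<longrightarrow> x $ j = y $ j) \<longrightarrow> h x = h y) \<and>
     coord c ` (\<Omega> \<inter> cdom c) = {x \<in> coord c ` cdom c. h x < x $ i}"

definition lipschitz_boundary ::
  "('m::topological_space, 'n::finite) chart set \<Rightarrow> 'm set \<Rightarrow> bool" where
  "lipschitz_boundary \<A> \<Omega> \<longleftrightarrow>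
     (\<forall>p\<in>frontier \<Omega>. \<exists>c i h. p \<in> cdom c \<and> lipschitz_graph_chart \<A> \<Omega> c i h)"

definition graph_point :: "'n \<Rightarrow> (real^'n \<Rightarrow> real) \<Rightarrow> real^'n \<Rightarrow> real^'n" where
  "graph_point i h x = (\<chi> j. if j = i then h x else x $ j)"

text \<open>On the graph \<open>x\<^sub>i = h x\<close> the induced area element is
  \<open>sqrt (det g) * sqrt (g\<^sup>-\<^sup>1(\<nu>, \<nu>))\<close> times Lebesgue measure in the other coordinates, where
  \<open>\<nu> = d(x\<^sub>i - h)\<close>. Integration over the other coordinates is written as integration over the
  whole space with the dummy variable \<open>x\<^sub>i\<close> confined to the unit interval. The gradient
  of \<open>h\<close> exists almost everywhere (Rademacher).\<close>

definition graph_conormal :: "'n::finite \<Rightarrow> (real^'n \<Rightarrow> real) \<Rightarrow> real^'n \<Rightarrow> real^'n" where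
  "graph_conormal i h x = axis i 1 - (\<chi> j. pderiv_at j h x)"

definition boundary_measure ::
  "('m::topological_space, 'n::finite) chart set \<Rightarrow> ('m, 'n) metric \<Rightarrow> 'm set \<Rightarrow> 'm measure \<Rightarrow> bool"
where
  "boundary_measure \<A> g \<Omega> \<sigma> \<longleftrightarrow> (\<exists>B. sets B = sets borel \<and> \<sigma> = completion B \<and>
     emeasure B (- frontier \<Omega>) = 0 \<and>
     (\<forall>c i h. lipschitz_graph_chart \<A> \<Omega> c i h \<longrightarrow>
       (\<forall>E\<in>sets borel. E \<subseteq> cdom c \<inter> frontier \<Omega> \<longrightarrow>
          emeasure B E =
            (\<integral>\<^sup>+x. indicator {x. 0 \<le> x $ i \<and> x $ i \<le> 1 \<and> graph_point i h x \<in> coord c ` E} x *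
               ennreal (let G = g c (param c (graph_point i h x)); \<nu> = graph_conormal i h x
                        in sqrt (det G) * sqrt (\<nu> \<bullet> (matrix_inv G *v \<nu>))) \<partial>lebesgue))))"


section \<open>Function spaces on a domain\<close>

definition L2_fun :: "'m measure \<Rightarrow> ('m \<Rightarrow> complex) \<Rightarrow> bool" where
  "L2_fun M f \<longleftrightarrow> f \<in> borel_measurable M \<and> integrable M (\<lambda>x. (cmod (f x))\<^sup>2)"

definition Lp_norm :: "'m measure \<Rightarrow> ennreal \<Rightarrow> ('m \<Rightarrow> real) \<Rightarrow> ennreal" where
  "Lp_norm M q f =
     (if q = \<infinity> then esssup M (\<lambda>x. ennreal \<bar>f x\<bar>)
      else let I = (\<integral>\<^sup>+x. ennreal (\<bar>f x\<bar> powr enn2real q) \<partial>M)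
           in if I = \<infinity> then \<infinity> else ennreal (enn2real I powr (1 / enn2real q)))"

definition laplace_beltrami ::
  "('m, 'n::finite) chart set \<Rightarrow> ('m, 'n) metric \<Rightarrow> ('m \<Rightarrow> real) \<Rightarrow> 'm \<Rightarrow> real" where
  "laplace_beltrami \<A> g \<theta> p =
     (let c = chart_at \<A> p; \<rho> = (\<lambda>x. sqrt (det (g c (param c x))))
      in (1 / \<rho> (coord c p)) *
         (\<Sum>i\<in>UNIV. pderiv_at i
            (\<lambda>x. \<rho> x * (\<Sum>j\<in>UNIV. matrix_inv (g c (param c x)) $ i $ j *
                                   pderiv_at j (\<theta> \<circ> param c) x))
            (coord c p)))"

text \<open>The function \<open>f\<close> is the Laplacian of \<open>y\<close> on \<open>\<Omega>\<close> in the sense of distributions.\<close>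

definition distr_laplacian ::
  "('m::topological_space, 'n::finite) chart set \<Rightarrow> ('m, 'n) metric \<Rightarrow> 'm measure \<Rightarrow> 'm set \<Rightarrow>
   ('m \<Rightarrow> complex) \<Rightarrow> ('m \<Rightarrow> complex) \<Rightarrow> bool" where
  "distr_laplacian \<A> g V \<Omega> y f \<longleftrightarrow>
     (\<forall>\<theta>::'m \<Rightarrow> real. smooth_fun \<A> \<theta> \<and> (\<exists>K. compact K \<and> K \<subseteq> \<Omega> \<and> (\<forall>p. p \<notin> K \<longrightarrow> \<theta> p = 0)) \<longrightarrow>
        (LINT p:\<Omega>|V. of_real (\<theta> p) * f p) =
        (LINT p:\<Omega>|V. of_real (laplace_beltrami \<A> g \<theta> p) * y p))"

text \<open>Complex covector fields, by components in each chart. The transformation law is required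
  at every point, so that pointwise invariants do not depend on the choice made by
  \<^const>\<open>chart_at\<close>.\<close>

type_synonym ('m, 'n) cofield = "('m, 'n) chart \<Rightarrow> 'm \<Rightarrow> complex^'n"

definition covector_field ::
  "('m, 'n::finite) chart set \<Rightarrow> 'm set \<Rightarrow> ('m, 'n) cofield \<Rightarrow> bool" where
  "covector_field \<A> \<Omega> w \<longleftrightarrow>
     (\<forall>c\<in>\<A>. \<forall>d\<in>\<A>. \<forall>p\<in>\<Omega> \<inter> cdom c \<inter> cdom d. \<forall>i.
        w c p $ i =
          (\<Sum>k\<in>UNIV. of_real (jacobian (transition c d) (at (coord c p)) $ k $ i) * w d p $ k))"

definition cov_inner ::
  "('m, 'n::finite) chart set \<Rightarrow> ('m, 'n) metric \<Rightarrow> ('m, 'n) cofield \<Rightarrow> ('m, 'n) cofield \<Rightarrow>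
   'm \<Rightarrow> complex" where
  "cov_inner \<A> g w z p =
     (let c = chart_at \<A> p
      in \<Sum>i\<in>UNIV. \<Sum>j\<in>UNIV. of_real (matrix_inv (g c p) $ i $ j) * w c p $ i * cnj (z c p $ j))"

definition cov_norm2 ::
  "('m, 'n::finite) chart set \<Rightarrow> ('m, 'n) metric \<Rightarrow> ('m, 'n) cofield \<Rightarrow> 'm \<Rightarrow> ennreal" where
  "cov_norm2 \<A> g w p = ennreal (Re (cov_inner \<A> g w w p))"

definition differential :: "('m \<Rightarrow> complex) \<Rightarrow> ('m, 'n::finite) cofield" where
  "differential u c p = (\<chi> i. pderiv_at i (u \<circ> param c) (coord c p))"

text \<open>The function \<open>y\<close> belongs to the Sobolev space of order one on \<open>\<Omega>\<close>, with weak
  differential \<open>w\<close>.\<close>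

definition H1_fun ::
  "('m::topological_space, 'n::finite) chart set \<Rightarrow> ('m, 'n) metric \<Rightarrow> 'm measure \<Rightarrow> 'm set \<Rightarrow>
   ('m \<Rightarrow> complex) \<Rightarrow> ('m, 'n) cofield \<Rightarrow> bool" where
  "H1_fun \<A> g V \<Omega> y w \<longleftrightarrow>
     L2_fun (restrict_space V \<Omega>) y \<and> covector_field \<A> \<Omega> w \<and>
     (\<forall>c\<in>\<A>. \<forall>i. (\<lambda>p. w c p $ i) \<in> borel_measurable (restrict_space V (\<Omega> \<inter> cdom c))) \<and>
     (\<integral>\<^sup>+p. cov_norm2 \<A> g w p \<partial>restrict_space V \<Omega>) < \<infinity> \<and>
     (\<forall>c\<in>\<A>. \<forall>i. \<forall>\<theta>::real^'n \<Rightarrow> real.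
        smooth_on UNIV \<theta> \<and>
        (\<exists>K. compact K \<and> K \<subseteq> coord c ` (\<Omega> \<inter> cdom c) \<and> (\<forall>x. x \<notin> K \<longrightarrow> \<theta> x = 0)) \<longrightarrow>
        (LINT x|lebesgue. of_real (pderiv_at i \<theta> x) * y (param c x)) =
        - (LINT x|lebesgue. of_real (\<theta> x) * w c (param c x) $ i))"


section \<open>Boundary conditions and the operator\<close>

text \<open>The trace on the boundary: extension of the restriction map by density of the functions
  that are smooth up to the boundary.\<close>

definition has_trace ::
  "('m::topological_space, 'n::finite) chart set \<Rightarrow> ('m, 'n) metric \<Rightarrow> 'm measure \<Rightarrow> 'm measure \<Rightarrow>
   'm set \<Rightarrow> ('m \<Rightarrow> complex) \<Rightarrow> ('m \<Rightarrow> complex) \<Rightarrow> bool" where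
  "has_trace \<A> g V \<sigma> \<Omega> y t \<longleftrightarrow>
     L2_fun (restrict_space \<sigma> (frontier \<Omega>)) t \<and>
     (\<exists>w u. H1_fun \<A> g V \<Omega> y w \<and> (\<forall>k::nat. smooth_fun \<A> (u k)) \<and>
        (\<lambda>k. \<integral>\<^sup>+p. ennreal ((cmod (u k p - y p))\<^sup>2) \<partial>restrict_space V \<Omega>) \<longlonglongrightarrow> 0 \<and>
        (\<lambda>k. \<integral>\<^sup>+p. cov_norm2 \<A> g (\<lambda>c q. differential (u k) c q - w c q) p
               \<partial>restrict_space V \<Omega>) \<longlonglongrightarrow> 0 \<and>
        (\<lambda>k. \<integral>\<^sup>+p. ennreal ((cmod (u k p - t p))\<^sup>2) \<partial>restrict_space \<sigma> (frontier \<Omega>)) \<longlonglongrightarrow> 0)"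

text \<open>The outward normal derivative of \<open>y\<close> on the part \<open>\<Gamma>\<close> of the boundary equals \<open>h\<close>, in the
  sense of Green's formula.\<close>

definition has_normal_derivative ::
  "('m::topological_space, 'n::finite) chart set \<Rightarrow> ('m, 'n) metric \<Rightarrow> 'm measure \<Rightarrow> 'm measure \<Rightarrow>
   'm set \<Rightarrow> 'm set \<Rightarrow> ('m \<Rightarrow> complex) \<Rightarrow> ('m \<Rightarrow> complex) \<Rightarrow> bool" where
  "has_normal_derivative \<A> g V \<sigma> \<Omega> \<Gamma> y h \<longleftrightarrow>
     L2_fun (restrict_space \<sigma> \<Gamma>) h \<and>
     (\<exists>w f. H1_fun \<A> g V \<Omega> y w \<and> L2_fun (restrict_space V \<Omega>) f \<and> distr_laplacian \<A> g V \<Omega> y f \<and>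
        (\<forall>v z s. H1_fun \<A> g V \<Omega> v z \<and> has_trace \<A> g V \<sigma> \<Omega> v s \<and>
             (AE p in \<sigma>. p \<in> frontier \<Omega> - \<Gamma> \<longrightarrow> s p = 0) \<longrightarrow>
           (LINT p:\<Omega>|V. cov_inner \<A> g w z p) + (LINT p:\<Omega>|V. f p * cnj (v p)) =
           (LINT p:\<Gamma>|\<sigma>. h p * cnj (s p))))"

datatype 'm bdry_cond =
    No_Boundary
  | Dirichlet
  | Neumann
  | Mixed "'m set" "'m set"
  | Robin "'m \<Rightarrow> real"

fun admissible_bc ::
  "'m::topological_space measure \<Rightarrow> 'm set \<Rightarrow> 'm bdry_cond \<Rightarrow> bool" where
  "admissible_bc \<sigma> \<Omega> No_Boundary \<longleftrightarrow> frontier \<Omega> = {}"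
| "admissible_bc \<sigma> \<Omega> Dirichlet \<longleftrightarrow> frontier \<Omega> \<noteq> {}"
| "admissible_bc \<sigma> \<Omega> Neumann \<longleftrightarrow> frontier \<Omega> \<noteq> {}"
| "admissible_bc \<sigma> \<Omega> (Mixed \<Gamma>\<^sub>0 \<Gamma>\<^sub>1) \<longleftrightarrow> frontier \<Omega> \<noteq> {} \<and>
     \<Gamma>\<^sub>0 \<in> sets \<sigma> \<and> \<Gamma>\<^sub>1 \<in> sets \<sigma> \<and> frontier \<Omega> = \<Gamma>\<^sub>0 \<union> \<Gamma>\<^sub>1 \<and> \<Gamma>\<^sub>0 \<inter> \<Gamma>\<^sub>1 = {}"
| "admissible_bc \<sigma> \<Omega> (Robin \<beta>) \<longleftrightarrow> frontier \<Omega> \<noteq> {} \<and>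
     \<beta> \<in> borel_measurable (restrict_space \<sigma> (frontier \<Omega>)) \<and>
     (\<exists>C. \<forall>p\<in>frontier \<Omega>. 0 \<le> \<beta> p \<and> \<beta> p \<le> C) \<and>
     0 < (\<integral>\<^sup>+p. ennreal (\<beta> p) \<partial>restrict_space \<sigma> (frontier \<Omega>))"

fun satisfies_bc ::
  "('m::topological_space, 'n::finite) chart set \<Rightarrow> ('m, 'n) metric \<Rightarrow> 'm measure \<Rightarrow> 'm measure \<Rightarrow>
   'm set \<Rightarrow> 'm bdry_cond \<Rightarrow> ('m \<Rightarrow> complex) \<Rightarrow> bool" where
  "satisfies_bc \<A> g V \<sigma> \<Omega> No_Boundary y \<longleftrightarrow> True"
| "satisfies_bc \<A> g V \<sigma> \<Omega> Dirichlet y \<longleftrightarrow> has_trace \<A> g V \<sigma> \<Omega> y (\<lambda>_. 0)"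
| "satisfies_bc \<A> g V \<sigma> \<Omega> Neumann y \<longleftrightarrow>
     has_normal_derivative \<A> g V \<sigma> \<Omega> (frontier \<Omega>) y (\<lambda>_. 0)"
| "satisfies_bc \<A> g V \<sigma> \<Omega> (Mixed \<Gamma>\<^sub>0 \<Gamma>\<^sub>1) y \<longleftrightarrow>
     (\<exists>t. has_trace \<A> g V \<sigma> \<Omega> y t \<and> (AE p in \<sigma>. p \<in> \<Gamma>\<^sub>0 \<longrightarrow> t p = 0)) \<and>
     has_normal_derivative \<A> g V \<sigma> \<Omega> \<Gamma>\<^sub>1 y (\<lambda>_. 0)"
| "satisfies_bc \<A> g V \<sigma> \<Omega> (Robin \<beta>) y \<longleftrightarrow>
     (\<exists>t. has_trace \<A> g V \<sigma> \<Omega> y t \<and>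
        has_normal_derivative \<A> g V \<sigma> \<Omega> (frontier \<Omega>) y (\<lambda>p. - of_real (\<beta> p) * t p))"

definition state_space :: "'m measure \<Rightarrow> 'm set \<Rightarrow> 'm bdry_cond \<Rightarrow> ('m \<Rightarrow> complex) set" where
  "state_space V \<Omega> bc =
     {y. L2_fun (restrict_space V \<Omega>) y \<and>
         (bc = Neumann \<or> bc = No_Boundary \<longrightarrow> (LINT p:\<Omega>|V. y p) = 0)}"

text \<open>The graph of the operator \<open>A\<close>, minus the Laplacian on its domain.\<close>

definition op_graph ::
  "('m::topological_space, 'n::finite) chart set \<Rightarrow> ('m, 'n) metric \<Rightarrow> 'm measure \<Rightarrow> 'm measure \<Rightarrow>
   'm set \<Rightarrow> 'm bdry_cond \<Rightarrow> (('m \<Rightarrow> complex) \<times> ('m \<Rightarrow> complex)) set" where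
  "op_graph \<A> g V \<sigma> \<Omega> bc =
     {(y, f). y \<in> state_space V \<Omega> bc \<and> f \<in> state_space V \<Omega> bc \<and>
              distr_laplacian \<A> g V \<Omega> y (\<lambda>p. - f p) \<and> satisfies_bc \<A> g V \<sigma> \<Omega> bc y}"

text \<open>Sequences indexed by the positive integers are functions on \<^typ>\<open>nat\<close> whose value at
  \<open>0\<close> is ignored.\<close>

definition orthonormal_basis ::
  "'m measure \<Rightarrow> 'm set \<Rightarrow> 'm bdry_cond \<Rightarrow> (nat \<Rightarrow> 'm \<Rightarrow> real) \<Rightarrow> bool" where
  "orthonormal_basis V \<Omega> bc \<phi> \<longleftrightarrow>
     (\<forall>j\<ge>1. (\<lambda>p. complex_of_real (\<phi> j p)) \<in> state_space V \<Omega> bc) \<and>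
     (\<forall>i\<ge>1. \<forall>j\<ge>1. (LINT p:\<Omega>|V. \<phi> i p * \<phi> j p) = (if i = j then 1 else 0)) \<and>
     (\<forall>y\<in>state_space V \<Omega> bc. \<forall>\<epsilon>>0. \<exists>N. \<exists>a::nat \<Rightarrow> complex.
        (\<integral>\<^sup>+p. ennreal ((cmod (y p - (\<Sum>j=1..N. a j * of_real (\<phi> j p))))\<^sup>2) \<partial>restrict_space V \<Omega>)
          < ennreal \<epsilon>)"

definition eigenbasis ::
  "('m::topological_space, 'n::finite) chart set \<Rightarrow> ('m, 'n) metric \<Rightarrow> 'm measure \<Rightarrow> 'm measure \<Rightarrow>
   'm set \<Rightarrow> 'm bdry_cond \<Rightarrow> (nat \<Rightarrow> 'm \<Rightarrow> real) \<Rightarrow> (nat \<Rightarrow> real) \<Rightarrow> bool" where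
  "eigenbasis \<A> g V \<sigma> \<Omega> bc \<phi> lam \<longleftrightarrow>
     orthonormal_basis V \<Omega> bc \<phi> \<and>
     (\<forall>j\<ge>1. 0 < lam j \<and>
        (\<lambda>p. complex_of_real (\<phi> j p), \<lambda>p. complex_of_real ((lam j)\<^sup>2 * \<phi> j p))
          \<in> op_graph \<A> g V \<sigma> \<Omega> bc) \<and>
     (\<forall>i\<ge>1. \<forall>j\<ge>i. lam i \<le> lam j)"


section \<open>Quantum unique ergodicity and the admissible sets\<close>

definition vaguely_converges_on ::
  "'m::topological_space set \<Rightarrow> (nat \<Rightarrow> 'm measure) \<Rightarrow> 'm measure \<Rightarrow> bool" where
  "vaguely_converges_on \<Omega> \<mu> \<nu> \<longleftrightarrow>
     (\<forall>f::'m \<Rightarrow> real. continuous_on UNIV f \<and>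
        (\<exists>K. compact K \<and> K \<subseteq> \<Omega> \<and> (\<forall>p. p \<notin> K \<longrightarrow> f p = 0)) \<longrightarrow>
        (\<lambda>j. LINT p|\<mu> j. f p) \<longlonglongrightarrow> (LINT p|\<nu>. f p))"

definition QUE_on_base ::
  "'m::topological_space measure \<Rightarrow> 'm set \<Rightarrow> (nat \<Rightarrow> 'm \<Rightarrow> real) \<Rightarrow> bool" where
  "QUE_on_base V \<Omega> \<phi> \<longleftrightarrow>
     vaguely_converges_on \<Omega>
       (\<lambda>j. density (restrict_space V \<Omega>) (\<lambda>p. ennreal ((\<phi> j p)\<^sup>2)))
       (uniform_measure (restrict_space V \<Omega>) \<Omega>)"

definition uniformly_Lp_bounded ::
  "'m measure \<Rightarrow> 'm set \<Rightarrow> (nat \<Rightarrow> 'm \<Rightarrow> real) \<Rightarrow> bool" where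
  "uniformly_Lp_bounded V \<Omega> \<phi> \<longleftrightarrow>
     (\<exists>p>1. \<exists>A\<^sub>0::real. 0 < A\<^sub>0 \<and>
        (\<forall>j\<ge>1. Lp_norm (restrict_space V \<Omega>) (2 * p) (\<phi> j) \<le> ennreal A\<^sub>0))"

text \<open>The sets \<open>\<omega>\<close> whose characteristic functions are the admissible ones.\<close>

definition U_L_b :: "'m::topological_space measure \<Rightarrow> 'm set \<Rightarrow> real \<Rightarrow> 'm set set" where
  "U_L_b V \<Omega> L =
     {\<omega>. \<omega> \<subseteq> \<Omega> \<and> \<omega> \<in> sets V \<and> emeasure V \<omega> = ennreal L * emeasure V \<Omega> \<and>
         emeasure V (frontier \<omega>) = 0}"

end

theory Submission
  imports Defs
begin

text \<open>
  Write \<open>u\<^sub>j = \<phi>\<^sub>j\<^sup>2\<close>; each \<open>u\<^sub>j\<close> has integral \<open>1\<close> over \<open>\<Omega>\<close>. The \<open>L\<^sup>p\<close> bound enters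
  through equi-integrability: the mass of \<open>u\<^sub>j\<close> on a set of small volume is small, uniformly in
  \<open>j\<close>. With it, vague convergence to the uniform measure improves to convergence of the integrals
  over every measurable set (\<open>weak_limit_of_vague_limit\<close>). Hence the integrals of \<open>u\<^sub>j\<close> over a set of
  volume \<open>L V(\<Omega>)\<close> tend to \<open>L\<close>, and their infimum is at most \<open>L\<close>.

  For the reverse inequality one set has to give almost \<open>L\<close> to all \<open>u\<^sub>j\<close> at once. Two partial
  constructions are at hand. For finitely many of the \<open>u\<^sub>j\<close>, a Jordan set \<open>J\<close> contains Jordan sets
  \<open>E\<close> with exactly the fraction \<open>t\<close> of its volume and approximately the fraction \<open>t\<close> of the mass of
  each of them: \<open>E\<close> is taken so finely spread over \<open>J\<close> that it looks like the constant density \<open>t\<close>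
  (\<open>jordan_split_functions\<close>). Conversely, for any fixed \<open>E\<close> of this volume the weak limit takes care
  of all large \<open>j\<close>. What is left is a finite range of intermediate indices, depending on \<open>E\<close>.

  To absorb these, cut \<open>J\<close> into \<open>m\<close> pieces so small that no \<open>u\<^sub>j\<close> has mass more than \<open>\<epsilon>\<close> on any of
  them, and select a subset of each piece in turn, making it good for all indices up to the point
  from which on the previously selected subsets are good. Then the bad ranges of the pieces are
  disjoint, so that every \<open>u\<^sub>j\<close> sees at most one bad piece and loses at most \<open>\<epsilon>\<close> there
  (\<open>uniform_selection\<close>). The number of pieces is fixed beforehand, so the remaining errors can be made
  small as well.

  The selected set must have a boundary of volume zero. All sets in the construction are therefore
  Boolean combinations of coordinate boxes whose closures lie in \<open>\<Omega>\<close>. Staying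
  away from \<open>\<partial>\<Omega>\<close> costs little: by equi-integrability the \<open>u\<^sub>j\<close> have little mass outside a large
  finite union of boxes.
\<close>

section \<open>Weak convergence of equi-integrable sequences\<close>

definition weight :: "'a measure \<Rightarrow> ('a \<Rightarrow> real) \<Rightarrow> bool" where
  "weight M w \<longleftrightarrow> w \<in> borel_measurable M \<and> (\<forall>x. 0 \<le> w x \<and> w x \<le> 1)"

text \<open>On a finite measure space this is uniform integrability of a nonnegative sequence, stated for
  weights instead of truncations: weights cover both the indicators of sets and the continuous
  functions against which vague convergence is tested.\<close>

definition equi_integrable :: "'a measure \<Rightarrow> (nat \<Rightarrow> 'a \<Rightarrow> real) \<Rightarrow> bool" where
  "equi_integrable M u \<longleftrightarrow>
     (\<forall>k. integrable M (u k)) \<and> (\<forall>k x. 0 \<le> u k x) \<and>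
     (\<forall>\<epsilon>>0. \<exists>T. \<forall>k w. weight M w \<longrightarrow>
        (LINT x|M. w x * u k x) \<le> T * (LINT x|M. w x) + \<epsilon>)"

lemma weight_indicator: "E \<in> sets M \<Longrightarrow> weight M (indicator E)"
  by (auto simp: weight_def indicator_def)

lemma integrable_weight:
  assumes "finite_measure M" "weight M w" shows "integrable M w"
proof -
  interpret finite_measure M by fact
  show ?thesis
    by (rule integrable_const_bound[where B = 1]) (use assms(2) in \<open>auto simp: weight_def\<close>)
qed

lemma integrable_weight_mult:
  assumes "weight M w" "integrable M u" shows "integrable M (\<lambda>x. w x * u x :: real)"
proof (rule Bochner_Integration.integrable_bound[OF assms(2)])
  show "(\<lambda>x. w x * u x) \<in> borel_measurable M"
    using assms by (auto simp: weight_def)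
  show "AE x in M. norm (w x * u x) \<le> norm (u x)"
    using assms by (auto simp: weight_def abs_mult intro!: AE_I2 mult_left_le_one_le)
qed

lemma equi_integrable_bounded:
  assumes M: "finite_measure M" and u: "\<And>k. weight M (u k)"
  shows "equi_integrable M u"
proof -
  have "(LINT x|M. w x * u k x) \<le> 1 * (LINT x|M. w x) + \<epsilon>" if "\<epsilon> > 0" "weight M w" for \<epsilon> k w
  proof -
    have "(LINT x|M. w x * u k x) \<le> (LINT x|M. w x)"
      by (intro integral_mono integrable_weight_mult integrable_weight[OF M] that u mult_right_le_one_le)
        (use u that in \<open>auto simp: weight_def\<close>)
    with that show ?thesis by simp
  qed
  with u integrable_weight[OF M u] show ?thesis
    unfolding equi_integrable_def by (metis weight_def)
qed

lemma equi_integrable_small_sets: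
  assumes M: "finite_measure M" and u: "equi_integrable M u" and "\<epsilon> > 0"
  obtains \<delta> where "\<delta> > 0"
    "\<And>k E. E \<in> sets M \<Longrightarrow> measure M E \<le> \<delta> \<Longrightarrow> (LINT x|M. indicator E x * u k x) \<le> \<epsilon>"
proof -
  obtain T where T: "\<And>k w. weight M w \<Longrightarrow> (LINT x|M. w x * u k x) \<le> T * (LINT x|M. w x) + \<epsilon> / 2"
    using u \<open>\<epsilon> > 0\<close> unfolding equi_integrable_def by (meson half_gt_zero)
  define \<delta> where "\<delta> = \<epsilon> / (2 * (\<bar>T\<bar> + 1))"
  have d: "\<delta> > 0" using \<open>\<epsilon> > 0\<close> by (auto simp: \<delta>_def)
  have "(LINT x|M. indicator E x * u k x) \<le> \<epsilon>" if E: "E \<in> sets M" "measure M E \<le> \<delta>" for k E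
  proof -
    have "T * measure M E \<le> (\<bar>T\<bar> + 1) * \<delta>"
      using d E by (intro mult_mono) auto
    also have "\<dots> = \<epsilon> / 2" by (simp add: \<delta>_def field_simps)
    finally have "T * measure M E \<le> \<epsilon> / 2" .
    moreover have "(LINT x|M. indicator E x) = measure M E"
      using E(1) by simp
    ultimately show ?thesis
      using T[OF weight_indicator[OF E(1)], of k] by simp
  qed
  with d that show thesis by blast
qed

text \<open>Equi-integrability makes the error of replacing \<open>w\<close> by \<open>w\<^sub>n\<close> uniformly small in the
  sequence, so that the two limits may be interchanged.\<close>

lemma weak_limit_closed:
  fixes w :: "'a \<Rightarrow> real"
  assumes M: "finite_measure M" and u: "equi_integrable M u" and v: "integrable M v"
    and wn: "\<And>n. weight M (wn n)" and w: "weight M w"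
    and lim: "\<And>x. x \<in> space M \<Longrightarrow> (\<lambda>n. wn n x) \<longlonglongrightarrow> w x"
    and conv: "\<And>n. (\<lambda>k. LINT x|M. wn n x * u k x) \<longlonglongrightarrow> (LINT x|M. wn n x * v x)"
  shows "(\<lambda>k. LINT x|M. w x * u k x) \<longlonglongrightarrow> (LINT x|M. w x * v x)"
proof (rule LIMSEQ_I)
  fix r :: real assume r: "r > 0"
  interpret finite_measure M by fact
  define d where "d n x = \<bar>w x - wn n x\<bar>" for n x
  have dw: "weight M (d n)" for n
    using w wn[of n] unfolding weight_def d_def
    by (auto simp: abs_le_iff) (metis add.commute add_increasing diff_le_eq le_add_same_cancel1 order_trans)+
  have d0: "(\<lambda>n. d n x) \<longlonglongrightarrow> 0" if "x \<in> space M" for x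
  proof -
    have "(\<lambda>n. \<bar>w x - wn n x\<bar>) \<longlonglongrightarrow> \<bar>w x - w x\<bar>"
      by (intro tendsto_intros lim that)
    then show ?thesis by (simp add: d_def)
  qed
  have ui: "integrable M (u k)" and u0: "0 \<le> u k x" for k x
    using u by (auto simp: equi_integrable_def)
  obtain T where T: "\<And>k w. weight M w \<Longrightarrow> (LINT x|M. w x * u k x) \<le> T * (LINT x|M. w x) + r/8"
    using u r unfolding equi_integrable_def
    by (meson zero_less_divide_iff zero_less_numeral)
  have I1: "(\<lambda>n. LINT x|M. d n x) \<longlonglongrightarrow> (LINT x|M. 0)"
    by (rule integral_dominated_convergence[where w = "\<lambda>_. 1"])
      (use dw d0 in \<open>auto simp: weight_def\<close>)
  have I2: "(\<lambda>n. LINT x|M. d n x * \<bar>v x\<bar>) \<longlonglongrightarrow> (LINT x|M. 0)"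
  proof (rule integral_dominated_convergence[where w = "\<lambda>x. \<bar>v x\<bar>"])
    show "AE x in M. (\<lambda>n. d n x * \<bar>v x\<bar>) \<longlonglongrightarrow> 0"
      using d0 by (auto intro!: AE_I2 tendsto_mult_left_zero)
    show "AE x in M. norm (d n x * \<bar>v x\<bar>) \<le> \<bar>v x\<bar>" for n
      using dw by (auto simp: weight_def abs_mult intro!: AE_I2 mult_left_le_one_le)
  qed (use v dw in \<open>auto simp: weight_def intro!: borel_measurable_times\<close>)
  have I1': "(\<lambda>n. T * (LINT x|M. d n x)) \<longlonglongrightarrow> 0"
    using tendsto_mult_left[OF I1, of T] by simp
  have "\<forall>\<^sub>F n in sequentially. T * (LINT x|M. d n x) < r/8 \<and> (LINT x|M. d n x * \<bar>v x\<bar>) < r/4"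
    using order_tendstoD(2)[OF I1', of "r/8"] order_tendstoD(2)[OF I2, of "r/4"] r
    by (auto intro: eventually_conj)
  then obtain n where n: "T * (LINT x|M. d n x) < r/8" "(LINT x|M. d n x * \<bar>v x\<bar>) < r/4"
    by (auto simp: eventually_sequentially)
  have diff: "\<bar>(LINT x|M. w x * h x) - (LINT x|M. wn n x * h x)\<bar> \<le> (LINT x|M. d n x * \<bar>h x\<bar>)"
    if h: "integrable M h" for h
  proof -
    have "(LINT x|M. w x * h x) - (LINT x|M. wn n x * h x) = (LINT x|M. w x * h x - wn n x * h x)"
      by (intro Bochner_Integration.integral_diff[symmetric] integrable_weight_mult w wn h)
    also have "\<bar>\<dots>\<bar> \<le> (LINT x|M. \<bar>w x * h x - wn n x * h x\<bar>)"
      by (rule integral_abs_bound)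
    also have "\<dots> = (LINT x|M. d n x * \<bar>h x\<bar>)"
      by (simp add: d_def abs_mult left_diff_distrib[symmetric])
    finally show ?thesis .
  qed
  obtain K where K: "\<And>k. k \<ge> K \<Longrightarrow> \<bar>(LINT x|M. wn n x * u k x) - (LINT x|M. wn n x * v x)\<bar> < r/4"
    using LIMSEQ_D[OF conv[of n], of "r/4"] r by auto
  show "\<exists>K. \<forall>k\<ge>K. norm ((LINT x|M. w x * u k x) - (LINT x|M. w x * v x)) < r"
  proof (intro exI allI impI)
    fix k assume "k \<ge> K"
    have "\<bar>(LINT x|M. w x * u k x) - (LINT x|M. wn n x * u k x)\<bar> \<le> (LINT x|M. d n x * u k x)"
      using diff[OF ui, of k] u0 by simp
    also have "\<dots> < r/4" using T[OF dw, of n k] n(1) by simp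
    finally show "norm ((LINT x|M. w x * u k x) - (LINT x|M. w x * v x)) < r"
      using K[OF \<open>k \<ge> K\<close>] diff[OF v] n(2) by (simp add: abs_if split: if_splits)
  qed
qed

text \<open>The sets on which the integrals converge form a Dynkin system, by
  \<open>weak_limit_closed\<close> for the countable unions; hence a generating \<open>\<pi>\<close>-system suffices.\<close>

lemma weak_limit_from_pi_system:
  assumes M: "finite_measure M" and u: "equi_integrable M u" and v: "integrable M v"
    and G: "Int_stable G" "G \<subseteq> sets M"
    and sp: "(\<lambda>k. LINT x|M. u k x) \<longlonglongrightarrow> (LINT x|M. v x)"
    and conv: "\<And>E. E \<in> G \<Longrightarrow>
      (\<lambda>k. LINT x|M. indicator E x * u k x) \<longlonglongrightarrow> (LINT x|M. indicator E x * v x)"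
    and E: "E \<in> sigma_sets (space M) G"
  shows "(\<lambda>k. LINT x|M. indicator E x * u k x) \<longlonglongrightarrow> (LINT x|M. indicator E x * v x)"
proof -
  have ss: "sigma_sets (space M) G \<subseteq> sets M"
    using G(2) by (rule sets.sigma_sets_subset)
  have ui: "integrable M (u k)" for k using u by (auto simp: equi_integrable_def)
  have Gp: "G \<subseteq> Pow (space M)" using G(2) sets.sets_into_space by auto
  from G(1) Gp E show ?thesis
  proof (induction rule: sigma_sets_induct_disjoint)
    case (basic A)
    then show ?case by (rule conv)
  next
    case empty
    then show ?case by simp
  next
    case (compl A)
    have A: "A \<in> sets M" using compl ss by auto
    have *: "(LINT x|M. indicator (space M - A) x * h x) =
        (LINT x|M. h x) - (LINT x|M. indicator A x * h x)" if h: "integrable M h" for h :: "_ \<Rightarrow> real"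
    proof -
      have "(LINT x|M. indicator (space M - A) x * h x) = (LINT x|M. h x - indicator A x * h x)"
        by (rule Bochner_Integration.integral_cong) (auto simp: indicator_def)
      then show ?thesis
        using h A by (simp add: integrable_weight_mult weight_indicator)
    qed
    show ?case unfolding *[OF ui] *[OF v] by (intro tendsto_diff sp compl)
  next
    case (union A)
    have A: "A i \<in> sets M" for i using union ss by auto
    define S where "S n = (\<Union>i<n. A i)" for n
    have Ss: "S n \<in> sets M" for n using A by (auto simp: S_def)
    show ?case
    proof (rule weak_limit_closed[OF M u v, where wn = "\<lambda>n. indicator (S n)"])
      show "(\<lambda>n. indicator (S n) x :: real) \<longlonglongrightarrow> indicator (\<Union>(range A)) x" for x
        unfolding S_def by (rule LIMSEQ_indicator_UN)
      fix n
      have *: "(LINT x|M. indicator (S n) x * h x) = (\<Sum>i<n. (LINT x|M. indicator (A i) x * h x))"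
        if h: "integrable M h" for h :: "_ \<Rightarrow> real"
      proof -
        have "(indicator (S n) x :: real) = (\<Sum>i<n. indicator (A i) x)" for x
          unfolding S_def using \<open>disjoint_family A\<close>
          by (subst indicator_UN_disjoint) (auto simp: disjoint_family_on_def)
        then have "(LINT x|M. indicator (S n) x * h x) = (LINT x|M. (\<Sum>i<n. indicator (A i) x * h x))"
          by (simp only: sum_distrib_right)
        also have "\<dots> = (\<Sum>i<n. (LINT x|M. indicator (A i) x * h x))"
          by (intro Bochner_Integration.integral_sum integrable_weight_mult weight_indicator A h)
        finally show ?thesis .
      qed
      show "(\<lambda>k. LINT x|M. indicator (S n) x * u k x) \<longlonglongrightarrow> (LINT x|M. indicator (S n) x * v x)"
        unfolding *[OF ui] *[OF v] by (intro tendsto_sum union)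
    qed (auto intro!: weight_indicator Ss A)
  qed
qed

text \<open>Here the sequence is bounded by \<open>1\<close>, so the roles are exchanged: an integrable test function is
  approximated in \<open>L\<^sup>1\<close> by simple functions, with an error that is uniform in the sequence.\<close>

lemma weak_limit_integrable_test:
  fixes f :: "'a \<Rightarrow> real"
  assumes M: "finite_measure M" and u: "\<And>k. weight M (u k)" and v: "weight M v"
    and conv: "\<And>E. E \<in> sets M \<Longrightarrow>
      (\<lambda>k. LINT x|M. indicator E x * u k x) \<longlonglongrightarrow> (LINT x|M. indicator E x * v x)"
    and f: "integrable M f"
  shows "(\<lambda>k. LINT x|M. u k x * f x) \<longlonglongrightarrow> (LINT x|M. v x * f x)"
  using f
proof (induction rule: integrable_induct)
  case (base A c)
  show ?case
    using tendsto_mult_right[OF conv[OF base(1)], of c]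
    by (simp add: mult.commute mult.left_commute)
next
  case (add f g)
  show ?case
    using tendsto_add[OF add.IH] add.hyps
    by (simp add: distrib_left integrable_weight_mult u v)
next
  case (lim f s)
  have I: "(\<lambda>n. LINT x|M. \<bar>f x - s n x\<bar>) \<longlonglongrightarrow> (LINT x|M. 0)"
  proof (rule integral_dominated_convergence[where w = "\<lambda>x. 3 * \<bar>f x\<bar>"])
    show "AE x in M. (\<lambda>n. \<bar>f x - s n x\<bar>) \<longlonglongrightarrow> 0"
    proof (rule AE_I2)
      fix x assume "x \<in> space M"
      then have "(\<lambda>n. \<bar>f x - s n x\<bar>) \<longlonglongrightarrow> \<bar>f x - f x\<bar>"
        by (intro tendsto_intros lim)
      then show "(\<lambda>n. \<bar>f x - s n x\<bar>) \<longlonglongrightarrow> 0" by simp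
    qed
    show "AE x in M. norm \<bar>f x - s n x\<bar> \<le> 3 * \<bar>f x\<bar>" for n
    proof (rule AE_I2)
      fix x assume "x \<in> space M"
      then have "\<bar>s n x\<bar> \<le> 2 * \<bar>f x\<bar>" using lim(3) by (simp add: real_norm_def)
      then show "norm \<bar>f x - s n x\<bar> \<le> 3 * \<bar>f x\<bar>" by auto
    qed
  qed (use lim in auto)
  show ?case
  proof (rule LIMSEQ_I)
    fix r :: real assume r: "r > 0"
    then obtain n where n: "(LINT x|M. \<bar>f x - s n x\<bar>) < r/3"
      using order_tendstoD(2)[OF I, of "r/3"] by (auto simp: eventually_sequentially)
    have sn: "integrable M (s n)" by (rule lim)
    have diff: "\<bar>(LINT x|M. h x * f x) - (LINT x|M. h x * s n x)\<bar> < r/3" if h: "weight M h" for h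
    proof -
      have "(LINT x|M. h x * f x) - (LINT x|M. h x * s n x) = (LINT x|M. h x * (f x - s n x))"
        using lim sn h by (simp add: right_diff_distrib integrable_weight_mult)
      also have "\<bar>\<dots>\<bar> \<le> (LINT x|M. \<bar>h x * (f x - s n x)\<bar>)"
        by (rule integral_abs_bound)
      also have "\<dots> \<le> (LINT x|M. \<bar>f x - s n x\<bar>)"
        using h lim sn
        by (intro integral_mono integrable_abs integrable_weight_mult)
          (auto simp: weight_def abs_mult intro!: mult_left_le_one_le)
      finally show ?thesis using n by simp
    qed
    obtain K where K: "\<And>k. k \<ge> K \<Longrightarrow> \<bar>(LINT x|M. u k x * s n x) - (LINT x|M. v x * s n x)\<bar> < r/3"
      using LIMSEQ_D[OF lim.IH[of n], of "r/3"] r by auto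
    have "norm ((LINT x|M. u k x * f x) - (LINT x|M. v x * f x)) < r" if "k \<ge> K" for k
      using diff[OF u, of k] diff[OF v] K[OF that] by (simp add: abs_if split: if_splits)
    then show "\<exists>K. \<forall>k\<ge>K. norm ((LINT x|M. u k x * f x) - (LINT x|M. v x * f x)) < r"
      by blast
  qed
qed

text \<open>For finite \<open>p > 1\<close> and \<open>y \<ge> 0\<close>, \<open>y \<le> T + T powr (1 - p) * y powr p\<close> at every level \<open>T > 0\<close>; with
  \<open>y = (f k x)\<^sup>2\<close> the second term has small integral for large \<open>T\<close>. For \<open>p = \<infinity>\<close> the squares are
  uniformly bounded.\<close>

lemma equi_integrable_of_Lp_bound:
  fixes f :: "nat \<Rightarrow> 'a \<Rightarrow> real"
  assumes M: "finite_measure M" and f: "\<And>k. integrable M (\<lambda>x. (f k x)\<^sup>2)"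
    and m: "\<And>k. f k \<in> borel_measurable M"
    and p: "p > 1" and bd: "\<And>k. Lp_norm M (2 * p) (f k) \<le> ennreal A"
  shows "equi_integrable M (\<lambda>k x. (f k x)\<^sup>2)"
proof -
  interpret finite_measure M by fact
  have "\<exists>T. \<forall>k w. weight M w \<longrightarrow>
          (LINT x|M. w x * (f k x)\<^sup>2) \<le> T * (LINT x|M. w x) + \<epsilon>" if e: "\<epsilon> > 0" for \<epsilon> :: real
  proof (cases "p = \<infinity>")
    case True
    have inf: "2 * p = \<infinity>" using True by (simp add: ennreal_mult_eq_top_iff infinity_ennreal_def)
    define B where "B = max 0 A"
    have eB: "ennreal A = ennreal B" by (simp add: B_def max_def ennreal_neg)
    have B0: "B \<ge> 0" by (simp add: B_def)
    have ae: "AE x in M. (f k x)\<^sup>2 \<le> B\<^sup>2" for k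
    proof -
      have "esssup M (\<lambda>x. ennreal \<bar>f k x\<bar>) \<le> ennreal B"
        using bd[of k] inf eB by (simp add: Lp_norm_def)
      moreover have "AE x in M. ennreal \<bar>f k x\<bar> \<le> esssup M (\<lambda>x. ennreal \<bar>f k x\<bar>)"
        by (rule esssup_AE)
      ultimately have "AE x in M. ennreal \<bar>f k x\<bar> \<le> ennreal B" by (auto elim: order_trans)
      then show ?thesis
        by eventually_elim (use B0 in \<open>simp add: abs_le_square_iff[symmetric]\<close>)
    qed
    have "(LINT x|M. w x * (f k x)\<^sup>2) \<le> B\<^sup>2 * (LINT x|M. w x) + \<epsilon>" if w: "weight M w" for k w
    proof -
      have "(LINT x|M. w x * (f k x)\<^sup>2) \<le> (LINT x|M. B\<^sup>2 * w x)"
      proof (rule integral_mono_AE)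
        show "AE x in M. w x * (f k x)\<^sup>2 \<le> B\<^sup>2 * w x"
          using ae[of k] by eventually_elim
            (use w in \<open>auto simp: weight_def mult.commute intro!: mult_left_mono\<close>)
      qed (use w f integrable_weight[OF M w] in \<open>auto intro!: integrable_weight_mult\<close>)
      with e show ?thesis by simp
    qed
    then show ?thesis by blast
  next
    case False
    define q where "q = enn2real p"
    have pq: "p = ennreal q" using False by (simp add: q_def infinity_ennreal_def less_top)
    have q: "q > 1" using p unfolding pq by (simp add: ennreal_less_iff flip: ennreal_1)
    have p2: "2 * p = ennreal (2 * q)" using q by (simp add: pq ennreal_mult flip: ennreal_numeral)
    define B where "B = max 0 A"
    have eB: "ennreal A = ennreal B" by (simp add: B_def max_def ennreal_neg)
    have e2q: "enn2real (ennreal (2 * q)) = 2 * q" using q by simp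
    define C where "C = B powr (2 * q)"
    have I: "(\<integral>\<^sup>+x. ennreal (\<bar>f k x\<bar> powr (2 * q)) \<partial>M) \<le> ennreal C" for k
    proof -
      let ?I = "\<integral>\<^sup>+x. ennreal (\<bar>f k x\<bar> powr (2 * q)) \<partial>M"
      have b: "(if ?I = \<infinity> then \<infinity> else ennreal (enn2real ?I powr (1 / (2 * q)))) \<le> ennreal B"
        using bd[of k] unfolding Lp_norm_def p2 eB Let_def e2q by simp
      then have fin: "?I \<noteq> \<infinity>" by (auto simp: infinity_ennreal_def top_unique)
      with b have "ennreal (enn2real ?I powr (1 / (2 * q))) \<le> ennreal B" by simp
      then have "enn2real ?I powr (1 / (2 * q)) \<le> B" by (subst (asm) ennreal_le_iff) (simp add: B_def)
      then have "(enn2real ?I powr (1 / (2 * q))) powr (2 * q) \<le> C"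
        unfolding C_def using q by (intro powr_mono2) auto
      then have "enn2real ?I \<le> C" using q by (simp add: powr_powr)
      then show ?thesis using fin by (metis ennreal_enn2real ennreal_leI infinity_ennreal_def less_top)
    qed
    have F: "integrable M (\<lambda>x. \<bar>f k x\<bar> powr (2 * q))" for k
      using I[of k] m by (intro integrableI_bounded) (auto intro: le_less_trans)
    have FI: "(LINT x|M. \<bar>f k x\<bar> powr (2 * q)) \<le> C" for k
      using I[of k] nn_integral_eq_integral[OF F[of k]] by (auto simp: C_def)
    obtain T where T: "T > 0" "T powr (1 - q) * C < \<epsilon>"
    proof -
      have "((\<lambda>T. T powr (1 - q) * C) \<longlongrightarrow> 0 * C) at_top"
        by (intro tendsto_mult tendsto_const tendsto_neg_powr filterlim_ident) (use q in auto)
      then have "\<forall>\<^sub>F T in at_top. T powr (1 - q) * C < \<epsilon>"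
        using e by (intro order_tendstoD(2)) auto
      then have "\<forall>\<^sub>F T in at_top. T powr (1 - q) * C < \<epsilon> \<and> T > 0"
        using eventually_gt_at_top[of 0] by (rule eventually_conj)
      then obtain T where "T powr (1 - q) * C < \<epsilon> \<and> T > 0"
        by (auto simp: eventually_at_top_linorder)
      with that show thesis by blast
    qed
    have pt: "a * y\<^sup>2 \<le> T * a + T powr (1 - q) * \<bar>y\<bar> powr (2 * q)" if a: "0 \<le> a" "a \<le> 1" for a y :: real
    proof (cases "y\<^sup>2 \<le> T")
      case True
      then have "a * y\<^sup>2 \<le> a * T" using a by (intro mult_left_mono)
      moreover have "0 \<le> T powr (1 - q) * \<bar>y\<bar> powr (2 * q)" by simp
      ultimately show ?thesis unfolding mult.commute[of a T] by linarith
    next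
      case yT: False
      then have y: "\<bar>y\<bar> > 0" using T by (cases "y = 0") auto
      have "y\<^sup>2 = (y\<^sup>2) powr (1 - q) * (y\<^sup>2) powr q"
        using y by (simp flip: powr_add)
      also have "(y\<^sup>2) powr q = (\<bar>y\<bar> powr 2) powr q"
        using y by simp
      also have "(\<bar>y\<bar> powr 2) powr q = \<bar>y\<bar> powr (2 * q)"
        by (rule powr_powr)
      also have "(y\<^sup>2) powr (1 - q) * \<bar>y\<bar> powr (2 * q) \<le> T powr (1 - q) * \<bar>y\<bar> powr (2 * q)"
        using yT T q by (intro mult_right_mono powr_mono2') auto
      finally have "y\<^sup>2 \<le> T powr (1 - q) * \<bar>y\<bar> powr (2 * q)" .
      moreover have "a * y\<^sup>2 \<le> y\<^sup>2" using a by (intro mult_left_le_one_le) auto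
      moreover have "0 \<le> T * a" using T a by simp
      ultimately show ?thesis by simp
    qed
    have "(LINT x|M. w x * (f k x)\<^sup>2) \<le> T * (LINT x|M. w x) + \<epsilon>" if w: "weight M w" for k w
    proof -
      have "(LINT x|M. w x * (f k x)\<^sup>2) \<le>
          (LINT x|M. T * w x + T powr (1 - q) * \<bar>f k x\<bar> powr (2 * q))"
        using w f F integrable_weight[OF M w]
        by (intro integral_mono integrable_weight_mult pt) (auto simp: weight_def)
      also have "\<dots> = T * (LINT x|M. w x) + T powr (1 - q) * (LINT x|M. \<bar>f k x\<bar> powr (2 * q))"
        using F integrable_weight[OF M w] by simp
      also have "T powr (1 - q) * (LINT x|M. \<bar>f k x\<bar> powr (2 * q)) \<le> T powr (1 - q) * C"
        using FI by (intro mult_left_mono) auto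
      finally show ?thesis using T by simp
    qed
    then show ?thesis by blast
  qed
  with f show ?thesis unfolding equi_integrable_def by auto
qed

section \<open>Jordan measurable sets\<close>

lemma null_frontier_subset:
  assumes "sets borel \<subseteq> sets V"
  shows "frontier A \<in> null_sets V \<Longrightarrow> frontier B \<in> null_sets V \<Longrightarrow>
    frontier D \<subseteq> frontier A \<union> frontier B \<Longrightarrow> frontier D \<in> null_sets V"
  by (rule null_sets_subset[OF null_sets.Un]) (use assms in auto)

lemma null_frontier_Int:
  assumes "sets borel \<subseteq> sets V"
  shows "frontier A \<in> null_sets V \<Longrightarrow> frontier B \<in> null_sets V \<Longrightarrow> frontier (A \<inter> B) \<in> null_sets V"
  by (erule (1) null_frontier_subset[OF assms]) (rule frontier_Int_subset)

text \<open>What the construction takes from the geometry: a sequence \<open>C\<close> of compact sets with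
  null frontier inside the open set \<open>\<Omega>\<close>, a bump function \<open>b i\<close> supported in each, so that the sets
  on which the bumps are positive form a basis of the topology of \<open>\<Omega>\<close>, and the possibility of dividing exactly
  the part of a set that lies in one cell. Measurable sets are Borel up to null sets, as for the
  completion of a Borel measure.\<close>

locale jordan_cells =
  fixes V :: "'m::topological_space measure" and \<Omega> :: "'m set"
    and C :: "nat \<Rightarrow> 'm set" and b :: "nat \<Rightarrow> 'm \<Rightarrow> real"
  assumes borel_subset: "sets borel \<subseteq> sets V"
    and ae_borel: "\<And>E. E \<in> sets V \<Longrightarrow> \<exists>E'\<in>sets borel. AE x in V. x \<in> E \<longleftrightarrow> x \<in> E'"
    and open_domain: "open \<Omega>"
    and finite_volume: "emeasure V \<Omega> < \<infinity>"
    and cell_compact: "\<And>i. compact (C i)"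
    and cell_closed: "\<And>i. closed (C i)"
    and cell_subset: "\<And>i. C i \<subseteq> \<Omega>"
    and cell_frontier: "\<And>i. frontier (C i) \<in> null_sets V"
    and bump_continuous: "\<And>i. continuous_on UNIV (b i)"
    and bump_nonneg: "\<And>i p. 0 \<le> b i p"
    and bump_support: "\<And>i p. p \<notin> C i \<Longrightarrow> b i p = 0"
    and cell_basis: "\<And>U p. open U \<Longrightarrow> U \<subseteq> \<Omega> \<Longrightarrow> p \<in> U \<Longrightarrow> \<exists>i. 0 < b i p \<and> C i \<subseteq> U"
    and cell_split: "\<And>J i t. J \<in> sets borel \<Longrightarrow> frontier J \<in> null_sets V \<Longrightarrow> 0 \<le> t \<Longrightarrow> t \<le> 1 \<Longrightarrow>
      \<exists>E\<subseteq>J \<inter> C i. E \<in> sets borel \<and> frontier E \<in> null_sets V \<and>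
        measure V E = t * measure V (J \<inter> C i)"
begin

abbreviation M :: "'m measure" where
  "M \<equiv> restrict_space V \<Omega>"

abbreviation mass :: "('m \<Rightarrow> real) \<Rightarrow> 'm set \<Rightarrow> real" where
  "mass h E \<equiv> (LINT x|M. indicator E x * h x)"

text \<open>Being covered by finitely many cells, which are compact subsets of \<open>\<Omega>\<close>, keeps the closure of such
  a set, and so its frontier, inside \<open>\<Omega>\<close>.\<close>

definition jordan :: "'m set \<Rightarrow> bool" where
  "jordan J \<longleftrightarrow> J \<in> sets borel \<and> frontier J \<in> null_sets V \<and> (\<exists>n. J \<subseteq> (\<Union>i<n. C i))"

lemma space_V: "space V = UNIV"
  using subsetD[OF borel_subset, of UNIV] sets.sets_into_space[of UNIV V] by auto

lemma space_M [simp]: "space M = \<Omega>"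
  by (simp add: space_restrict_space space_V)

lemma domain_sets: "\<Omega> \<in> sets V"
  using open_domain borel_subset by auto

lemma sets_M: "E \<in> sets M \<longleftrightarrow> E \<subseteq> \<Omega> \<and> E \<in> sets V"
  using domain_sets by (subst sets_restrict_space_iff) (auto simp: space_V)

lemma borel_sets_M: "E \<in> sets borel \<Longrightarrow> E \<subseteq> \<Omega> \<Longrightarrow> E \<in> sets M"
  using borel_subset by (auto simp: sets_M)

lemma measure_M: "E \<subseteq> \<Omega> \<Longrightarrow> measure M E = measure V E"
  using domain_sets by (subst measure_restrict_space) (auto simp: space_V)

lemma finite_M: "finite_measure M"
  by (rule finite_measureI) (use finite_volume domain_sets in \<open>simp add: emeasure_restrict_space space_V\<close>)

sublocale finite_measure M
  by (rule finite_M)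

lemma continuous_measurable_M:
  assumes "continuous_on UNIV (f :: 'm \<Rightarrow> real)" shows "f \<in> borel_measurable M"
proof -
  have "f \<in> borel_measurable borel"
    using assms by (rule borel_measurable_continuous_onI)
  then have "f \<in> borel_measurable V"
    using borel_subset by (auto simp: measurable_def space_V)
  then show ?thesis by (rule measurable_restrict_space1)
qed

subsection \<open>Convergence on all measurable sets\<close>

lemma open_subsets_generate:
  assumes "E \<in> sets borel" "E \<subseteq> \<Omega>"
  shows "E \<in> sigma_sets \<Omega> {U. open U \<and> U \<subseteq> \<Omega>}"
proof -
  have "\<Omega> \<inter> E \<in> (\<inter>) \<Omega> ` sigma_sets UNIV {S. open S}"
    using assms by (auto simp: borel_def)
  also have "\<Omega> \<in> sigma_sets UNIV {S. open S}"
    using open_domain by (auto intro: sigma_sets.Basic)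
  then have "(\<inter>) \<Omega> ` sigma_sets UNIV {S. open S} = sigma_sets \<Omega> ((\<inter>) \<Omega> ` {S. open S})"
    by (intro sigma_sets_Int) auto
  also have "(\<inter>) \<Omega> ` {S. open S} = {U. open U \<and> U \<subseteq> \<Omega>}"
    using open_domain by (auto simp: image_iff)
  finally show ?thesis using assms by (simp add: Int_absorb1)
qed

lemma weak_limit_all_sets:
  assumes u: "equi_integrable M u" and v: "integrable M v"
    and G: "Int_stable G" "G \<subseteq> sets M" "{U. open U \<and> U \<subseteq> \<Omega>} \<subseteq> sigma_sets \<Omega> G"
    and sp: "(\<lambda>k. LINT x|M. u k x) \<longlonglongrightarrow> (LINT x|M. v x)"
    and conv: "\<And>E. E \<in> G \<Longrightarrow> (\<lambda>k. mass (u k) E) \<longlonglongrightarrow> mass v E"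
    and E: "E \<in> sets M"
  shows "(\<lambda>k. mass (u k) E) \<longlonglongrightarrow> mass v E"
proof -
  obtain E' where E': "E' \<in> sets borel" "AE x in V. x \<in> E \<longleftrightarrow> x \<in> E'"
    using ae_borel E by (auto simp: sets_M)
  define D where "D = \<Omega> \<inter> E'"
  have Db: "D \<in> sets borel" "D \<subseteq> \<Omega>" using E' open_domain by (auto simp: D_def)
  then have "D \<in> sigma_sets \<Omega> {U. open U \<and> U \<subseteq> \<Omega>}"
    by (rule open_subsets_generate)
  then have "D \<in> sigma_sets \<Omega> (sigma_sets \<Omega> G)"
    using sigma_sets_mono'[OF G(3)] by auto
  then have "D \<in> sigma_sets (space M) G"
    using sigma_sets_sigma_sets_eq[OF subset_trans[OF G(2) sets.space_closed]] by simp
  then have "(\<lambda>k. mass (u k) D) \<longlonglongrightarrow> mass v D"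
    by (intro weak_limit_from_pi_system[OF finite_M u v G(1,2) sp conv])
  moreover have "mass h D = mass h E" if "integrable M h" for h
  proof (rule integral_cong_AE)
    have "AE x in M. x \<in> E \<longleftrightarrow> x \<in> E'"
      using E'(2) domain_sets by (subst AE_restrict_space_iff) (auto simp: space_V)
    moreover have "AE x in M. x \<in> \<Omega>" by (auto intro: AE_I2)
    ultimately show "AE x in M. indicator D x * h x = indicator E x * h x"
      by eventually_elim (auto simp: D_def indicator_def)
  qed (use that E borel_sets_M[OF Db] in auto)
  moreover have "integrable M (u k)" for k using u by (auto simp: equi_integrable_def)
  ultimately show ?thesis using v by simp
qed

text \<open>An open subset of \<open>\<Omega>\<close> is a union of sets on which bumps are positive, so its indicator is a
  pointwise limit of continuous functions with compact support in \<open>\<Omega>\<close>. This gives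
  the convergence on open sets, which are a \<open>\<pi>\<close>-system generating the Borel sets.\<close>

lemma weak_limit_of_vague_limit:
  assumes u: "equi_integrable M u"
    and conv: "\<And>f K. continuous_on UNIV f \<Longrightarrow> compact K \<Longrightarrow> K \<subseteq> \<Omega> \<Longrightarrow> (\<And>p. p \<notin> K \<Longrightarrow> f p = 0) \<Longrightarrow>
      (\<lambda>k. LINT x|M. f x * u k x) \<longlonglongrightarrow> \<kappa> * (LINT x|M. f x)"
    and E: "E \<in> sets M"
  shows "(\<lambda>k. mass (u k) E) \<longlonglongrightarrow> \<kappa> * measure M E"
proof -
  have op: "(\<lambda>k. mass (u k) U) \<longlonglongrightarrow> mass (\<lambda>_. \<kappa>) U" if U: "open U" "U \<subseteq> \<Omega>" for U
  proof -
    define I where "I n = {i. i < n \<and> C i \<subseteq> U}" for n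
    \<comment> \<open>The factor \<open>n\<close> pushes the sum above \<open>1\<close> at every point where some bump is positive.\<close>
    define w where "w n x = min 1 (real n * (\<Sum>i\<in>I n. b i x))" for n x
    have fin: "finite (I n)" for n by (simp add: I_def)
    have cont: "continuous_on UNIV (w n)" for n
      unfolding w_def by (intro continuous_intros bump_continuous)
    have wt: "weight M (w n)" for n
      unfolding weight_def
      using continuous_measurable_M[OF cont, of n]
      by (auto simp: w_def intro!: mult_nonneg_nonneg sum_nonneg bump_nonneg)
    show ?thesis
    proof (rule weak_limit_closed[OF finite_M u _ wt weight_indicator])
      show "U \<in> sets M" using U by (intro borel_sets_M) auto
      show "(\<lambda>n. w n x) \<longlonglongrightarrow> indicator U x" for x
      proof (cases "x \<in> U")
        case False
        then have "b i x = 0" if "i \<in> I n" for i n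
          using that by (intro bump_support) (auto simp: I_def)
        then show ?thesis using False by (simp add: w_def)
      next
        case True
        then obtain i where i: "0 < b i x" "C i \<subseteq> U" using cell_basis[OF U] by blast
        obtain N where N: "1 < real N * b i x"
          using reals_Archimedean3[OF i(1)] by blast
        have "w n x = 1" if n: "n \<ge> max N (Suc i)" for n
        proof -
          have "b i x \<le> (\<Sum>i\<in>I n. b i x)"
            using n i by (intro member_le_sum bump_nonneg fin) (auto simp: I_def)
          then have "real N * b i x \<le> real n * (\<Sum>i\<in>I n. b i x)"
            using n i by (intro mult_mono) auto
          with N show ?thesis by (simp add: w_def)
        qed
        then have "\<forall>\<^sub>F n in sequentially. w n x = 1"
          using eventually_at_top_linorder by blast
        then show ?thesis using True by (simp add: tendsto_eventually)
      qed
      fix n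
      have "(\<lambda>k. LINT x|M. w n x * u k x) \<longlonglongrightarrow> \<kappa> * (LINT x|M. w n x)"
      proof (rule conv[OF cont])
        show "compact (\<Union>i\<in>I n. C i)" using fin cell_compact by (intro compact_UN) auto
        show "(\<Union>i\<in>I n. C i) \<subseteq> \<Omega>" using cell_subset by blast
        show "w n p = 0" if "p \<notin> (\<Union>i\<in>I n. C i)" for p
          using that bump_support by (auto simp: w_def sum.neutral)
      qed
      then show "(\<lambda>k. LINT x|M. w n x * u k x) \<longlonglongrightarrow> (LINT x|M. w n x * \<kappa>)"
        by (simp add: mult.commute)
    qed simp
  qed
  have full: "mass h \<Omega> = (LINT x|M. h x)" for h
    by (rule Bochner_Integration.integral_cong) auto
  have "(\<lambda>k. mass (u k) E) \<longlonglongrightarrow> mass (\<lambda>_. \<kappa>) E"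
  proof (rule weak_limit_all_sets[OF u _ _ _ _ _ _ E])
    show "Int_stable {U. open U \<and> U \<subseteq> \<Omega>}" by (auto simp: Int_stable_def)
    show "{U. open U \<and> U \<subseteq> \<Omega>} \<subseteq> sets M" by (auto intro: borel_sets_M)
    show "{U. open U \<and> U \<subseteq> \<Omega>} \<subseteq> sigma_sets \<Omega> {U. open U \<and> U \<subseteq> \<Omega>}" by auto
    show "(\<lambda>k. LINT x|M. u k x) \<longlonglongrightarrow> (LINT x|M. \<kappa>)"
      using op[of \<Omega>] open_domain by (simp only: full order_refl)
  qed (use op in auto)
  then show ?thesis using E sets_M[of E] by (simp add: mult.commute Int_absorb2)
qed

subsection \<open>Exact division of Jordan sets\<close>

lemma jordan_borel: "jordan J \<Longrightarrow> J \<in> sets borel"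
  by (simp add: jordan_def)

lemma jordan_subset: "jordan J \<Longrightarrow> J \<subseteq> \<Omega>"
  using cell_subset unfolding jordan_def by blast

lemma jordan_sets: "jordan J \<Longrightarrow> J \<in> sets M"
  using jordan_subset jordan_borel borel_sets_M by auto


lemma jordan_Un: "jordan A \<Longrightarrow> jordan B \<Longrightarrow> jordan (A \<union> B)"
  unfolding jordan_def
proof (elim conjE exE, intro conjI)
  fix m n assume "A \<subseteq> (\<Union>i<m. C i)" "B \<subseteq> (\<Union>i<n. C i)"
  then have "A \<union> B \<subseteq> (\<Union>i<max m n. C i)" by fastforce
  then show "\<exists>n. A \<union> B \<subseteq> (\<Union>i<n. C i)" by blast
qed (auto intro: null_frontier_subset[OF borel_subset _ _ frontier_Un_subset])

lemma jordan_Int: "jordan A \<Longrightarrow> B \<in> sets borel \<Longrightarrow> frontier B \<in> null_sets V \<Longrightarrow> jordan (A \<inter> B)"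
  unfolding jordan_def using null_frontier_Int[OF borel_subset] by blast

lemma jordan_Diff: "jordan A \<Longrightarrow> B \<in> sets borel \<Longrightarrow> frontier B \<in> null_sets V \<Longrightarrow> jordan (A - B)"
  using jordan_Int[of A "- B"] by (simp add: frontier_complement Diff_eq)

lemma jordan_Diff_jordan: "jordan A \<Longrightarrow> jordan B \<Longrightarrow> jordan (A - B)"
  by (rule jordan_Diff) (auto simp: jordan_def)

lemma jordan_empty: "jordan {}"
  by (auto simp: jordan_def)

lemma cell_borel: "C i \<in> sets borel"
  using cell_closed by auto

lemma jordan_UN_cells: "jordan (\<Union>i<n. C i)"
proof (induction n)
  case 0
  show ?case using jordan_empty by simp
next
  case (Suc n)
  have "C n \<subseteq> (\<Union>i<Suc n. C i)" by auto
  then have "jordan (C n)"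
    using cell_borel cell_frontier unfolding jordan_def by blast
  from jordan_Un[OF this Suc] show ?case by (simp add: lessThan_Suc)
qed

text \<open>Splitting off the cells one after the other reduces this to the division inside a single cell.\<close>

lemma jordan_split:
  assumes "jordan J" "0 \<le> t" "t \<le> 1"
  shows "\<exists>E\<subseteq>J. jordan E \<and> measure M E = t * measure M J"
proof -
  obtain n where "J \<subseteq> (\<Union>i<n. C i)" using assms by (auto simp: jordan_def)
  with assms(1) show ?thesis
  proof (induction n arbitrary: J)
    case 0
    then show ?case by (intro exI[of _ "{}"]) (auto intro: jordan_empty)
  next
    case (Suc n)
    have R: "jordan (J - C n)" by (intro jordan_Diff Suc cell_borel cell_frontier)
    have "J - C n \<subseteq> (\<Union>i<n. C i)" using Suc.prems(2) by (auto simp: lessThan_Suc)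
    from Suc.IH[OF R this] obtain E where E: "E \<subseteq> J - C n" "jordan E"
      "measure M E = t * measure M (J - C n)" by blast
    have Jb: "J \<in> sets borel" "frontier J \<in> null_sets V" using Suc.prems by (auto simp: jordan_def)
    obtain F where F: "F \<subseteq> J \<inter> C n" "F \<in> sets borel" "frontier F \<in> null_sets V"
      "measure V F = t * measure V (J \<inter> C n)"
      using cell_split[OF Jb assms(2,3), of n] by blast
    have J: "jordan (J \<inter> C n)" by (intro jordan_Int Suc cell_borel cell_frontier)
    have "F = (J \<inter> C n) \<inter> F" using F by auto
    then have FJ: "jordan F" using jordan_Int[OF J F(2,3)] by simp
    have "measure M (E \<union> F) = measure M E + measure M F"
      using E F by (intro finite_measure_Union jordan_sets FJ) auto
    also have "measure M F = t * measure M (J \<inter> C n)"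
      using F(4) jordan_subset[OF FJ] jordan_subset[OF J] by (simp add: measure_M)
    also have "measure M E + t * measure M (J \<inter> C n) = t * (measure M (J - C n) + measure M (J \<inter> C n))"
      by (simp add: E distrib_left)
    also have "measure M (J - C n) + measure M (J \<inter> C n) = measure M ((J - C n) \<union> (J \<inter> C n))"
      by (intro finite_measure_Union[symmetric] jordan_sets R J) auto
    also have "(J - C n) \<union> (J \<inter> C n) = J" by auto
    finally show ?case
      using jordan_Un[OF E(2) FJ] E(1) F(1) by (intro exI[of _ "E \<union> F"]) auto
  qed
qed

text \<open>Dividing separately the two parts of \<open>J\<close> inside and outside \<open>C k\<close> makes the fraction exact on both;
  iterating over \<open>k\<close> makes it exact on all intersections of the first cells.\<close>

lemma jordan_split_family:
  assumes "jordan J" "0 \<le> t" "t \<le> 1"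
  shows "\<exists>E\<subseteq>J. jordan E \<and>
    (\<forall>S\<subseteq>{..<k}. measure M (E \<inter> (\<Inter>i\<in>S. C i)) = t * measure M (J \<inter> (\<Inter>i\<in>S. C i)))"
  using assms(1)
proof (induction k arbitrary: J)
  case 0
  show ?case using jordan_split[OF 0 assms(2,3)] by auto
next
  case (Suc k)
  have JJ: "jordan (J \<inter> C k)" "jordan (J - C k)"
    by (intro jordan_Int jordan_Diff Suc.prems cell_borel cell_frontier)+
  obtain E where E: "E \<subseteq> J \<inter> C k" "jordan E"
    "\<And>S. S \<subseteq> {..<k} \<Longrightarrow> measure M (E \<inter> (\<Inter>i\<in>S. C i)) = t * measure M ((J \<inter> C k) \<inter> (\<Inter>i\<in>S. C i))"
    using Suc.IH[OF JJ(1)] by metis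
  obtain F where F: "F \<subseteq> J - C k" "jordan F"
    "\<And>S. S \<subseteq> {..<k} \<Longrightarrow> measure M (F \<inter> (\<Inter>i\<in>S. C i)) = t * measure M ((J - C k) \<inter> (\<Inter>i\<in>S. C i))"
    using Suc.IH[OF JJ(2)] by metis
  have "measure M ((E \<union> F) \<inter> (\<Inter>i\<in>S. C i)) = t * measure M (J \<inter> (\<Inter>i\<in>S. C i))"
    if S: "S \<subseteq> {..<Suc k}" for S
  proof (cases "k \<in> S")
    case True
    define S' where "S' = S - {k}"
    have S': "S' \<subseteq> {..<k}" "S = insert k S'" using S True by (auto simp: S'_def less_Suc_eq)
    have "(E \<union> F) \<inter> (\<Inter>i\<in>S. C i) = E \<inter> (\<Inter>i\<in>S'. C i)"
      "J \<inter> (\<Inter>i\<in>S. C i) = (J \<inter> C k) \<inter> (\<Inter>i\<in>S'. C i)"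
      using E(1) F(1) by (auto simp: S'(2))
    then show ?thesis using E(3)[OF S'(1)] by simp
  next
    case False
    then have S': "S \<subseteq> {..<k}" using S less_Suc_eq by auto
    have "(\<Inter>i\<in>S. C i) \<in> sets borel"
      using cell_closed by (intro borel_closed closed_INT) auto
    then have m: "A \<inter> (\<Inter>i\<in>S. C i) \<in> sets M" if "jordan A" for A
      using that jordan_subset[OF that] jordan_borel[OF that] by (intro borel_sets_M) auto
    have "measure M ((E \<union> F) \<inter> (\<Inter>i\<in>S. C i)) =
        measure M ((E \<inter> (\<Inter>i\<in>S. C i)) \<union> (F \<inter> (\<Inter>i\<in>S. C i)))"
      by (simp add: Int_Un_distrib2)
    also have "\<dots> = measure M (E \<inter> (\<Inter>i\<in>S. C i)) + measure M (F \<inter> (\<Inter>i\<in>S. C i))"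
      using E F by (intro finite_measure_Union m) auto
    also have "\<dots> = t * (measure M ((J \<inter> C k) \<inter> (\<Inter>i\<in>S. C i)) + measure M ((J - C k) \<inter> (\<Inter>i\<in>S. C i)))"
      by (simp add: E(3)[OF S'] F(3)[OF S'] distrib_left)
    also have "measure M ((J \<inter> C k) \<inter> (\<Inter>i\<in>S. C i)) + measure M ((J - C k) \<inter> (\<Inter>i\<in>S. C i)) =
        measure M (((J \<inter> C k) \<inter> (\<Inter>i\<in>S. C i)) \<union> ((J - C k) \<inter> (\<Inter>i\<in>S. C i)))"
      by (intro finite_measure_Union[symmetric] m JJ) auto
    also have "((J \<inter> C k) \<inter> (\<Inter>i\<in>S. C i)) \<union> ((J - C k) \<inter> (\<Inter>i\<in>S. C i)) = J \<inter> (\<Inter>i\<in>S. C i)" by auto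
    finally show ?thesis .
  qed
  then show ?case
    using jordan_Un[OF E(2) F(2)] E(1) F(1) by (intro exI[of _ "E \<union> F"]) auto
qed

lemma cells_generate_open:
  assumes "open U" "U \<subseteq> \<Omega>"
  shows "U \<in> sigma_sets \<Omega> {\<Omega> \<inter> (\<Inter>i\<in>S. C i) | S. finite S}" (is "U \<in> sigma_sets \<Omega> ?G")
proof -
  have "U = (\<Union>i\<in>{i. C i \<subseteq> U}. C i)"
    using cell_basis[OF assms] bump_support by force
  moreover have "C i \<in> ?G" for i
    using cell_subset by (intro CollectI exI[of _ "{i}"]) auto
  then have "(\<Union>i\<in>{i. C i \<subseteq> U}. C i) \<in> sigma_sets \<Omega> ?G"
    by (intro sigma_sets_UNION) auto
  ultimately show ?thesis by simp
qed

text \<open>Let \<open>E\<^sub>k \<subseteq> J\<close> have the exact fraction \<open>t\<close> on all intersections of the first \<open>k\<close> cells. On each fixed finite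
  intersection of cells the volumes of \<open>E\<^sub>k\<close> are then eventually constant, and these intersections are a generating
  \<open>\<pi>\<close>-system; hence the indicators of \<open>E\<^sub>k\<close> converge weakly to \<open>t\<close> times that of \<open>J\<close>, also against
  integrable functions. One \<open>E\<^sub>k\<close> with \<open>k\<close> large serves finitely many functions.\<close>

lemma jordan_split_functions:
  assumes J: "jordan J" and t: "0 \<le> t" "t \<le> 1"
    and f: "\<And>j. j < (N::nat) \<Longrightarrow> integrable M (f j)" and \<eta>: "\<eta> > 0"
  shows "\<exists>E\<subseteq>J. jordan E \<and> measure M E = t * measure M J \<and>
    (\<forall>j<N. \<bar>mass (f j) E - t * mass (f j) J\<bar> < \<eta>)"
proof -
  have "\<forall>k. \<exists>E\<subseteq>J. jordan E \<and>
      (\<forall>S\<subseteq>{..<k}. measure M (E \<inter> (\<Inter>i\<in>S. C i)) = t * measure M (J \<inter> (\<Inter>i\<in>S. C i)))"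
    using jordan_split_family[OF J t] by blast
  then obtain E where E: "\<And>k. E k \<subseteq> J" "\<And>k. jordan (E k)"
    "\<And>k S. S \<subseteq> {..<k} \<Longrightarrow> measure M (E k \<inter> (\<Inter>i\<in>S. C i)) = t * measure M (J \<inter> (\<Inter>i\<in>S. C i))"
    by metis
  have ind: "(LINT x|M. indicator A x * indicator B x :: real) = measure M (A \<inter> B)"
    if "A \<in> sets M" "B \<in> sets M" for A B
    using that sets_M[of A] by (simp add: Int_absorb2 le_infI1 flip: indicator_inter_arith)
  let ?G = "{\<Omega> \<inter> (\<Inter>i\<in>S. C i) | S. finite S}"
  have GM: "?G \<subseteq> sets M"
  proof clarify
    fix S :: "nat set" assume "finite S"
    have "(\<Inter>i\<in>S. C i) \<in> sets borel"
      using cell_closed by (intro borel_closed closed_INT) auto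
    then show "\<Omega> \<inter> (\<Inter>i\<in>S. C i) \<in> sets M"
      using open_domain by (intro borel_sets_M) auto
  qed
  have wE: "weight M (indicator (E k))" for k
    by (intro weight_indicator jordan_sets E)
  have wJ: "weight M (\<lambda>x. t * indicator J x)"
    using t jordan_sets[OF J] by (auto simp: weight_def indicator_def)
  have iJ: "integrable M (\<lambda>x. t * indicator J x)"
    by (rule integrable_weight[OF finite_M wJ])
  have convG: "(\<lambda>k. LINT x|M. indicator A x * indicator (E k) x) \<longlonglongrightarrow>
      (LINT x|M. indicator A x * (t * indicator J x))" if A: "A \<in> ?G" for A
  proof -
    obtain S where S: "finite S" "A = \<Omega> \<inter> (\<Inter>i\<in>S. C i)" using A by auto
    obtain k0 where k0: "S \<subseteq> {..<k0}" using S(1) finite_nat_iff_bounded by blast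
    have As: "A \<in> sets M" using A GM by auto
    have rhs: "(LINT x|M. indicator A x * (t * indicator J x)) = t * measure M (A \<inter> J)"
      using ind[OF As jordan_sets[OF J]] by (simp add: mult.left_commute)
    have AI: "A \<inter> B = B \<inter> (\<Inter>i\<in>S. C i)" if "jordan B" for B
      using jordan_subset[OF that] by (auto simp: S(2))
    have "(LINT x|M. indicator A x * indicator (E k) x) =
        (LINT x|M. indicator A x * (t * indicator J x))" if "k \<ge> k0" for k
    proof -
      have "S \<subseteq> {..<k}" using k0 that by auto
      then show ?thesis
        unfolding rhs ind[OF As jordan_sets[OF E(2)]] AI[OF E(2)] AI[OF J] by (rule E(3))
    qed
    then show ?thesis
      by (intro tendsto_eventually) (auto simp: eventually_at_top_linorder)
  qed
  have all: "(\<lambda>k. LINT x|M. indicator A x * indicator (E k) x) \<longlonglongrightarrow>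
      (LINT x|M. indicator A x * (t * indicator J x))" if "A \<in> sets M" for A
  proof (rule weak_limit_all_sets[OF _ iJ _ GM _ _ convG that])
    show "equi_integrable M (\<lambda>k. indicator (E k))"
      by (rule equi_integrable_bounded[OF finite_M wE])
    show "Int_stable ?G"
    proof (rule Int_stableI)
      fix a b assume "a \<in> ?G" "b \<in> ?G"
      then obtain S T where "finite S" "a = \<Omega> \<inter> (\<Inter>i\<in>S. C i)" "finite T" "b = \<Omega> \<inter> (\<Inter>i\<in>T. C i)"
        by auto
      then show "a \<inter> b \<in> ?G"
        by (intro CollectI exI[of _ "S \<union> T"]) auto
    qed
    show "{U. open U \<and> U \<subseteq> \<Omega>} \<subseteq> sigma_sets \<Omega> ?G"
      using cells_generate_open by blast
    have "measure M (E k) = t * measure M J" for k using E(3)[of "{}" k] by simp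
    then show "(\<lambda>k. LINT x|M. indicator (E k) x) \<longlonglongrightarrow> (LINT x|M. t * indicator J x)"
      using jordan_subset[OF E(2)] jordan_sets[OF E(2)] jordan_sets[OF J] jordan_subset[OF J] by (simp add: Int_absorb2)
  qed
  have lim: "(\<lambda>k. mass (f j) (E k)) \<longlonglongrightarrow> t * mass (f j) J" if "j < N" for j
    using weak_limit_integrable_test[OF finite_M wE wJ all f[OF that]]
    by (simp add: mult.assoc)
  have "\<forall>\<^sub>F k in sequentially. \<bar>mass (f j) (E k) - t * mass (f j) J\<bar> < \<eta>" if "j < N" for j
    using tendstoD[OF lim[OF that] \<eta>] by (simp add: dist_real_def)
  then have "\<forall>\<^sub>F k in sequentially. \<forall>j\<in>{..<N}. \<bar>mass (f j) (E k) - t * mass (f j) J\<bar> < \<eta>"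
    by (intro eventually_ball_finite) auto
  then obtain k where "\<forall>j<N. \<bar>mass (f j) (E k) - t * mass (f j) J\<bar> < \<eta>"
    by (auto simp: eventually_sequentially)
  moreover have "measure M (E k) = t * measure M J" using E(3)[of "{}" k] by simp
  ultimately show ?thesis using E(1,2) by blast
qed

subsection \<open>A set that is good for the whole sequence\<close>

lemma mass_Un:
  assumes "integrable M h" "A \<in> sets M" "B \<in> sets M" "A \<inter> B = {}"
  shows "mass h (A \<union> B) = mass h A + mass h B"
proof -
  have "mass h (A \<union> B) = (LINT x|M. indicator A x * h x + indicator B x * h x)"
    using assms(4) by (intro Bochner_Integration.integral_cong) (auto simp: indicator_def)
  then show ?thesis
    using assms by (simp add: integrable_weight_mult weight_indicator)
qed

text \<open>Induction on the number \<open>m\<close> of pieces of volume at most \<open>\<delta>\<close>. Peel one piece \<open>F\<close> off \<open>J\<close> and let \<open>E1\<close>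
  be the set selected in the rest \<open>R\<close>. By weak convergence, from some index \<open>N\<close> on \<open>E1\<close> has its due share
  of \<open>R\<close> up to \<open>\<eta>/2\<close>. Choose \<open>E2 \<subseteq> F\<close> with its due share for the indices below \<open>N\<close>. Below \<open>N\<close> only \<open>R\<close>
  may cost \<open>\<epsilon>\<close>; from \<open>N\<close> on only \<open>F\<close> does, as its whole mass is at most \<open>\<epsilon>\<close>. So the error \<open>\<epsilon>\<close>
  occurs once, and not \<open>m\<close> times.\<close>

lemma uniform_selection:
  assumes u: "equi_integrable M u"
    and conv: "\<And>E. E \<in> sets M \<Longrightarrow> (\<lambda>k. mass (u k) E) \<longlonglongrightarrow> \<kappa> * measure M E"
    and small: "\<And>k E. E \<in> sets M \<Longrightarrow> measure M E \<le> \<delta> \<Longrightarrow> mass (u k) E \<le> \<epsilon>"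
    and \<delta>: "\<delta> > 0" and t: "0 \<le> t" "t \<le> 1"
    and J: "jordan J" "measure M J \<le> real m * \<delta>" and \<eta>: "\<eta> > 0"
  shows "\<exists>E\<subseteq>J. jordan E \<and> measure M E = t * measure M J \<and>
    (\<forall>k. t * mass (u k) J \<le> mass (u k) E + \<epsilon> + \<eta>)"
  using J \<eta>
proof (induction m arbitrary: J \<eta>)
  case 0
  have "mass (u k) J \<le> \<epsilon>" for k
    using small[OF jordan_sets] 0 \<delta> by simp
  moreover have "0 \<le> mass (u k) J" for k
    using u by (intro integral_nonneg_AE) (auto simp: equi_integrable_def)
  ultimately have "t * mass (u k) J \<le> \<epsilon>" for k
    using t by (meson mult_left_le_one_le order_trans)
  then show ?case
    using 0 measure_nonneg[of M J] by (intro exI[of _ "{}"]) (auto simp: jordan_empty intro: add_increasing2)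
next
  case (Suc m)
  have ui: "integrable M (u k)" for k using u by (auto simp: equi_integrable_def)
  have u0: "0 \<le> mass (u k) A" for k A
    using u by (intro integral_nonneg_AE) (auto simp: equi_integrable_def)
  obtain F where F: "F \<subseteq> J" "jordan F" "measure M F = 1 / real (Suc m) * measure M J"
    using jordan_split[OF Suc.prems(1), of "1 / real (Suc m)"] by auto
  define R where "R = J - F"
  have R: "jordan R" unfolding R_def by (intro jordan_Diff_jordan Suc F)
  have FR: "F \<inter> R = {}" "F \<union> R = J" using F by (auto simp: R_def)
  have Fd: "measure M F \<le> \<delta>"
    using Suc.prems(2) by (simp add: F(3) field_simps)
  have mJ: "measure M J = measure M F + measure M R"
    using finite_measure_Union[OF jordan_sets[OF F(2)] jordan_sets[OF R] FR(1)] FR by simp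
  then have "measure M R = real m / real (Suc m) * measure M J"
    by (simp add: F(3) field_simps)
  also have "\<dots> \<le> real m / real (Suc m) * (real (Suc m) * \<delta>)"
    using Suc.prems(2) by (intro mult_left_mono) auto
  finally have Rd: "measure M R \<le> real m * \<delta>" by simp
  from Suc.IH[OF R Rd, of "\<eta>/2"] obtain E1 where E1: "E1 \<subseteq> R" "jordan E1"
    "measure M E1 = t * measure M R" "\<And>k. t * mass (u k) R \<le> mass (u k) E1 + \<epsilon> + \<eta>/2"
    using Suc.prems(3) by auto
  have "(\<lambda>k. t * mass (u k) R - mass (u k) E1) \<longlonglongrightarrow> t * (\<kappa> * measure M R) - \<kappa> * measure M E1"
    by (intro tendsto_intros conv jordan_sets R E1)
  then have "(\<lambda>k. t * mass (u k) R - mass (u k) E1) \<longlonglongrightarrow> 0"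
    by (simp add: E1(3) mult.left_commute)
  from order_tendstoD(2)[OF this, of "\<eta>/2"] obtain N where
    N: "\<And>k. k \<ge> N \<Longrightarrow> t * mass (u k) R - mass (u k) E1 < \<eta>/2"
    using Suc.prems(3) by (auto simp: eventually_sequentially)
  obtain E2 where E2: "E2 \<subseteq> F" "jordan E2" "measure M E2 = t * measure M F"
    "\<And>k. k < N \<Longrightarrow> \<bar>mass (u k) E2 - t * mass (u k) F\<bar> < \<eta>/2"
    using jordan_split_functions[OF F(2) t, of N u "\<eta>/2"] ui Suc.prems(3) by auto
  have dis: "E2 \<inter> E1 = {}" using E1 E2 FR by auto
  have "measure M (E2 \<union> E1) = t * measure M J"
    using finite_measure_Union[OF jordan_sets[OF E2(2)] jordan_sets[OF E1(2)] dis]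
    by (simp add: E1(3) E2(3) mJ distrib_left)
  moreover have "t * mass (u k) J \<le> mass (u k) (E2 \<union> E1) + \<epsilon> + \<eta>" for k
  proof -
    have 1: "mass (u k) J = mass (u k) F + mass (u k) R"
      using mass_Un[OF ui jordan_sets[OF F(2)] jordan_sets[OF R] FR(1)] FR by simp
    have 2: "mass (u k) (E2 \<union> E1) = mass (u k) E2 + mass (u k) E1"
      by (rule mass_Un[OF ui jordan_sets[OF E2(2)] jordan_sets[OF E1(2)] dis])
    show ?thesis
    proof (cases "k < N")
      case True
      then show ?thesis using E2(4)[OF True] E1(4)[of k] unfolding 1 2 distrib_left by linarith
    next
      case False
      have "t * mass (u k) F \<le> mass (u k) F" using t u0 by (intro mult_left_le_one_le) auto
      also have "\<dots> \<le> \<epsilon>" by (intro small jordan_sets F Fd)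
      finally have "t * mass (u k) F \<le> \<epsilon>" .
      then show ?thesis
        using N[of k] False u0[of E2 k] Suc.prems(3) unfolding 1 2 distrib_left by linarith
    qed
  qed
  moreover have "E2 \<union> E1 \<subseteq> J" using E1 E2 FR by auto
  ultimately show ?case using jordan_Un[OF E2(2) E1(2)] by blast
qed

text \<open>The fraction \<open>t \<ge> L\<close> is chosen to make up for the volume of \<open>\<Omega>\<close> outside a large
  finite union \<open>J n\<close> of cells. Of the total loss \<open>\<epsilon>\<close> a third each is spent on the mass outside
  \<open>J n\<close> and on the two errors of the selection inside it.\<close>

lemma exists_uniform_set:
  assumes u: "equi_integrable M u"
    and conv: "\<And>E. E \<in> sets M \<Longrightarrow> (\<lambda>k. mass (u k) E) \<longlonglongrightarrow> \<kappa> * measure M E"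
    and one: "\<And>k. (LINT x|M. u k x) = 1"
    and pos: "0 < measure M \<Omega>" and L: "0 < L" "L < 1" and \<epsilon>: "\<epsilon> > 0"
  shows "\<exists>E. jordan E \<and> measure M E = L * measure M \<Omega> \<and> (\<forall>k. L - \<epsilon> \<le> mass (u k) E)"
proof -
  have ui: "integrable M (u k)" for k using u by (auto simp: equi_integrable_def)
  have \<Omega>M: "\<Omega> \<in> sets M" by (simp add: sets_M domain_sets)
  have full: "mass (u k) \<Omega> = 1" for k
    unfolding one[of k, symmetric] by (rule Bochner_Integration.integral_cong) auto
  obtain \<delta> where \<delta>: "\<delta> > 0"
    "\<And>k E. E \<in> sets M \<Longrightarrow> measure M E \<le> \<delta> \<Longrightarrow> mass (u k) E \<le> \<epsilon>/3"
    using equi_integrable_small_sets[OF finite_M u, of "\<epsilon>/3"] \<epsilon> by auto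
  define J where "J n = (\<Union>i<n. C i)" for n
  have Jj: "jordan (J n)" for n unfolding J_def by (rule jordan_UN_cells)
  have "(\<Union>n. J n) = \<Omega>"
  proof
    show "(\<Union>n. J n) \<subseteq> \<Omega>" using cell_subset by (auto simp: J_def)
    show "\<Omega> \<subseteq> (\<Union>n. J n)"
    proof
      fix p assume "p \<in> \<Omega>"
      then obtain i where "0 < b i p" using cell_basis[OF open_domain] by blast
      then have "p \<in> C i" using bump_support by force
      then show "p \<in> (\<Union>n. J n)" by (auto simp: J_def)
    qed
  qed
  moreover have "(\<lambda>n. measure M (J n)) \<longlonglongrightarrow> measure M (\<Union>n. J n)"
    by (rule finite_Lim_measure_incseq)
      (use jordan_sets[OF Jj] in \<open>auto simp: incseq_def J_def intro: order_less_le_trans\<close>)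
  ultimately have lim: "(\<lambda>n. measure M (J n)) \<longlonglongrightarrow> measure M \<Omega>" by simp
  have "L * measure M \<Omega> < measure M \<Omega>" "measure M \<Omega> - \<delta> < measure M \<Omega>" using L pos \<delta> by auto
  then have "\<forall>\<^sub>F n in sequentially. L * measure M \<Omega> < measure M (J n) \<and> measure M \<Omega> - \<delta> < measure M (J n)"
    by (intro eventually_conj order_tendstoD(1)[OF lim])
  then obtain n where n: "L * measure M \<Omega> < measure M (J n)" "measure M \<Omega> - \<delta> < measure M (J n)"
    by (auto simp: eventually_sequentially)
  have Jpos: "measure M (J n) > 0" using n(1) L pos by (meson less_trans mult_pos_pos)
  define t where "t = L * measure M \<Omega> / measure M (J n)"
  have tL: "L \<le> t"
    using L Jpos bounded_measure[of "J n"] by (simp add: t_def pos_le_divide_eq mult_left_mono)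
  have t: "0 \<le> t" "t \<le> 1" using tL L n Jpos by (auto simp: t_def)
  obtain m :: nat where m: "measure M (J n) \<le> real m * \<delta>"
    using reals_Archimedean3[OF \<delta>(1)] less_imp_le by blast
  have "\<epsilon>/3 > 0" using \<epsilon> by simp
  from uniform_selection[OF u conv \<delta>(2,1) t Jj m this]
  obtain E where E: "jordan E" "measure M E = t * measure M (J n)"
    "\<And>k. t * mass (u k) (J n) \<le> mass (u k) E + \<epsilon>/3 + \<epsilon>/3"
    by blast
  have Js: "J n \<in> sets M" "\<Omega> - J n \<in> sets M" using jordan_sets[OF Jj] \<Omega>M by auto
  have "measure M (\<Omega> - J n) \<le> \<delta>"
    using n(2) finite_measure_compl[OF Js(1)] by simp
  then have out: "mass (u k) (\<Omega> - J n) \<le> \<epsilon>/3" for k using \<delta>(2) Js(2) by blast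
  have "L - \<epsilon> \<le> mass (u k) E" for k
  proof -
    have "J n \<union> (\<Omega> - J n) = \<Omega>" using jordan_subset[OF Jj] by auto
    then have "mass (u k) (J n) + mass (u k) (\<Omega> - J n) = 1"
      using mass_Un[OF ui Js] full by simp
    then have J1: "1 - \<epsilon>/3 \<le> mass (u k) (J n)" using out[of k] by simp
    have J0: "0 \<le> mass (u k) (J n)"
      using u by (intro integral_nonneg_AE) (auto simp: equi_integrable_def)
    have "L - \<epsilon>/3 \<le> L * (1 - \<epsilon>/3)" using L \<epsilon> by (simp add: algebra_simps)
    also have "\<dots> \<le> L * mass (u k) (J n)" using L J1 by (intro mult_left_mono) auto
    also have "\<dots> \<le> t * mass (u k) (J n)" using tL J0 by (rule mult_right_mono)
    finally show ?thesis using E(3)[of k] by simp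
  qed
  moreover have "measure M E = L * measure M \<Omega>" using E(2) Jpos by (simp add: t_def)
  ultimately show ?thesis using E(1) by blast
qed

end

section \<open>Coordinate cells\<close>

definition cell :: "('m, 'n::finite) chart \<Rightarrow> real^'n \<Rightarrow> real^'n \<Rightarrow> 'm set" where
  "cell c l r = param c ` cbox l r"

definition open_cell :: "('m, 'n::finite) chart \<Rightarrow> real^'n \<Rightarrow> real^'n \<Rightarrow> 'm set" where
  "open_cell c l r = param c ` box l r"

text \<open>The distance to the complement of the box is positive exactly in the open box, so the bump is
  continuous on the whole manifold when extended by zero.\<close>

definition bump :: "('m, 'n::finite) chart \<Rightarrow> real^'n \<Rightarrow> real^'n \<Rightarrow> 'm \<Rightarrow> real" where
  "bump c l r p = (if p \<in> cell c l r then infdist (coord c p) (- box l r) else 0)"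

locale chart_cell =
  fixes c :: "('m::t2_space, 'n::finite) chart" and l r :: "real^'n"
  assumes chart: "is_chart c"
    and box_in_chart: "cbox l r \<subseteq> coord c ` cdom c"
begin

lemma open_cdom: "open (cdom c)"
  and cont_coord: "continuous_on (cdom c) (coord c)"
  and cont_param: "continuous_on (coord c ` cdom c) (param c)"
  and param_coord: "\<And>p. p \<in> cdom c \<Longrightarrow> param c (coord c p) = p"
proof -
  have h: "homeomorphism (cdom c) (coord c ` cdom c) (coord c) (param c)"
    using chart unfolding is_chart_def by blast
  show "open (cdom c)" using chart unfolding is_chart_def by blast
  show "continuous_on (cdom c) (coord c)" "continuous_on (coord c ` cdom c) (param c)"
    using homeomorphism_cont1[OF h] homeomorphism_cont2[OF h] .
  show "\<And>p. p \<in> cdom c \<Longrightarrow> param c (coord c p) = p" by (rule homeomorphism_apply1[OF h])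
qed

lemma in_param_image:
  assumes S: "S \<subseteq> coord c ` cdom c"
  shows "p \<in> param c ` S \<longleftrightarrow> p \<in> cdom c \<and> coord c p \<in> S"
proof
  assume "p \<in> param c ` S"
  then obtain x where x: "x \<in> S" "p = param c x" by blast
  then obtain q where "q \<in> cdom c" "x = coord c q" using S by blast
  then show "p \<in> cdom c \<and> coord c p \<in> S" using x by (simp add: param_coord)
next
  assume p: "p \<in> cdom c \<and> coord c p \<in> S"
  then have "p = param c (coord c p)" by (simp add: param_coord)
  with p show "p \<in> param c ` S" by blast
qed

lemma in_cell: "p \<in> cell c l r \<longleftrightarrow> p \<in> cdom c \<and> coord c p \<in> cbox l r"
  unfolding cell_def by (rule in_param_image[OF box_in_chart])

lemma in_open_cell: "p \<in> open_cell c l r \<longleftrightarrow> p \<in> cdom c \<and> coord c p \<in> box l r"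
  unfolding open_cell_def by (rule in_param_image[OF subset_trans[OF box_subset_cbox box_in_chart]])

lemma cell_compact: "compact (cell c l r)"
  unfolding cell_def
  by (intro compact_continuous_image continuous_on_subset[OF cont_param] box_in_chart compact_cbox)

lemma cell_closed: "closed (cell c l r)"
  by (rule compact_imp_closed[OF cell_compact])

lemma open_cell_open: "open (open_cell c l r)"
proof -
  have "open_cell c l r = cdom c \<inter> coord c -` box l r" by (auto simp: in_open_cell)
  then show ?thesis
    using continuous_open_preimage[OF cont_coord open_cdom open_box] by simp
qed

lemma frontier_cell: "frontier (cell c l r) \<subseteq> cell c l r - open_cell c l r"
proof -
  have "open_cell c l r \<subseteq> interior (cell c l r)"
    using box_subset_cbox[of l r] by (intro interior_maximal open_cell_open) (auto simp: in_cell in_open_cell)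
  then show ?thesis
    using cell_closed by (auto simp: frontier_def)
qed

lemma bump_continuous: "continuous_on UNIV (bump c l r)"
proof -
  have "continuous_on (cdom c) (\<lambda>p. infdist (coord c p) (- box l r))"
    by (intro continuous_intros cont_coord)
  then have 1: "continuous_on (cdom c) (bump c l r)"
  proof (rule continuous_on_eq)
    show "infdist (coord c p) (- box l r) = bump c l r p" if "p \<in> cdom c" for p
      using that subsetD[OF box_subset_cbox[of l r], of "coord c p"]
      by (auto simp: bump_def in_cell intro!: infdist_zero)
  qed
  have 2: "continuous_on (- cell c l r) (bump c l r)"
    by (rule continuous_on_eq[OF continuous_on_const[of _ 0]]) (simp add: bump_def)
  have "cdom c \<union> - cell c l r = UNIV" by (auto simp: in_cell)
  then show ?thesis
    using continuous_on_open_Un[OF open_cdom _ 1 2] cell_closed by (simp add: open_Compl)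
qed

lemma bump_pos: "p \<in> open_cell c l r \<Longrightarrow> 0 < bump c l r p"
proof -
  assume p: "p \<in> open_cell c l r"
  have "box l r \<noteq> UNIV" using bounded_box[of l r] not_bounded_UNIV by metis
  then have "- box l r \<noteq> {}" by (metis Compl_empty_eq double_complement)
  then have "infdist (coord c p) (- box l r) > 0"
    using p by (intro infdist_pos_not_in_closed) (auto simp: open_box in_open_cell)
  then show ?thesis
    using p box_subset_cbox[of l r] by (auto simp: bump_def in_cell in_open_cell)
qed

end

text \<open>In a chart the Riemannian volume has a density with respect to Lebesgue measure, so
  coordinate null sets are null sets of the manifold.\<close>

lemma null_set_of_chart:
  fixes c :: "('m::{t2_space, second_countable_topology}, 'n::finite) chart"
  assumes V: "riemannian_volume \<A> g V" and c: "c \<in> \<A>"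
    and E: "E \<in> sets borel" "E \<subseteq> cdom c" and N: "coord c ` E \<subseteq> N" "N \<in> null_sets lborel"
  shows "E \<in> null_sets V"
proof -
  obtain B where B: "sets B = sets borel" "V = completion B"
    "\<And>c E. c \<in> \<A> \<Longrightarrow> E \<in> sets borel \<Longrightarrow> E \<subseteq> cdom c \<Longrightarrow> emeasure B E =
        (\<integral>\<^sup>+x. indicator (coord c ` E) x * ennreal (sqrt (det (g c (param c x)))) \<partial>lborel)"
    using V unfolding riemannian_volume_def by blast
  \<comment> \<open>Bounding the density by \<open>\<infinity>\<close> avoids the question of its measurability.\<close>
  have "emeasure B E \<le> (\<integral>\<^sup>+x. \<infinity> * indicator N x \<partial>lborel)"
    unfolding B(3)[OF c E] using N(1)
    by (intro nn_integral_mono) (auto simp: indicator_def)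
  also have "\<dots> = \<infinity> * emeasure lborel N"
    using N by (intro nn_integral_cmult_indicator) auto
  also have "\<dots> = 0" using N by auto
  finally have "E \<in> null_sets B" using E(1) B(1) by (auto simp: null_sets_def)
  then show ?thesis unfolding B(2) by (rule null_sets_completionI)
qed

lemma null_set_lborel:
  fixes N :: "(real^'n::finite) set"
  assumes "negligible N" "N \<in> sets borel" shows "N \<in> null_sets lborel"
  using assms by (simp add: negligible_iff_null_sets null_sets_completion_iff)

lemma frontier_cell_null:
  fixes c :: "('m::{t2_space, second_countable_topology}, 'n::finite) chart"
  assumes V: "riemannian_volume \<A> g V" and c: "c \<in> \<A>" and cc: "chart_cell c l r"
  shows "frontier (cell c l r) \<in> null_sets V"
proof (rule null_set_of_chart[OF V c])
  interpret chart_cell c l r by fact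
  show "frontier (cell c l r) \<subseteq> cdom c" using frontier_cell by (auto simp: in_cell)
  show "coord c ` frontier (cell c l r) \<subseteq> cbox l r - box l r"
    using frontier_cell by (auto simp: in_cell in_open_cell)
  show "cbox l r - box l r \<in> null_sets lborel"
    by (intro null_set_lborel negligible_frontier_interval) auto
qed auto

text \<open>The level sets of a coordinate are null, so the volume of the part of \<open>J \<inter> cell c l r\<close>
  below the level \<open>s\<close> depends continuously on \<open>s\<close>.\<close>

lemma cell_splits:
  fixes c :: "('m::{t2_space, second_countable_topology}, 'n::finite) chart"
  assumes V: "riemannian_volume \<A> g V" and c: "c \<in> \<A>" and cc: "chart_cell c l r"
    and bV: "sets borel \<subseteq> sets V" and fin: "emeasure V (cell c l r) < \<infinity>"
    and J: "J \<in> sets borel" "frontier J \<in> null_sets V" and t: "0 \<le> t" "t \<le> 1"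
  shows "\<exists>E\<subseteq>J \<inter> cell c l r. E \<in> sets borel \<and> frontier E \<in> null_sets V \<and>
    measure V E = t * measure V (J \<inter> cell c l r)"
proof (cases "cell c l r = {}")
  case True
  then show ?thesis by (intro exI[of _ "{}"]) auto
next
  case False
  interpret chart_cell c l r by fact
  fix i :: 'n
  have lr: "l $ i \<le> r $ i" using False unfolding cell_def by (auto simp: cbox_interval less_eq_vec_def)
  define D where "D = J \<inter> cell c l r"
  define h where "h p = (if p \<in> cell c l r then coord c p $ i else 0)" for p
  have cellb: "cell c l r \<in> sets borel" using cell_closed by auto
  have hb: "h \<in> borel_measurable borel"
    unfolding h_def
  proof (rule borel_measurable_continuous_on_if[OF cellb])
    show "continuous_on (cell c l r) (\<lambda>p. coord c p $ i)"
      by (intro continuous_intros continuous_on_subset[OF cont_coord]) (auto simp: in_cell)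
  qed auto
  have sV: "space V = UNIV" using subsetD[OF bV, of UNIV] sets.sets_into_space[of UNIV V] by auto
  have hV: "h \<in> borel_measurable V"
    using hb bV by (auto simp: measurable_def sV)
  have Db: "D \<in> sets borel" "D \<in> sets V" using J cellb bV by (auto simp: D_def)
  have Dfin: "emeasure V D < \<infinity>"
    using emeasure_mono[of D "cell c l r" V] cellb bV fin by (auto simp: D_def intro: le_less_trans)
  define N where "N = restrict_space V D"
  \<comment> \<open>The volume below a level is the distribution function of the coordinate on \<open>D\<close>.\<close>
  define \<nu> where "\<nu> = distr N borel h"
  have hN: "h \<in> borel_measurable N" unfolding N_def by (rule measurable_restrict_space1[OF hV])
  have "finite_measure N"
    unfolding N_def by (rule finite_measureI) (use Dfin Db in \<open>simp add: emeasure_restrict_space sV\<close>)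
  then have "finite_measure \<nu>" unfolding \<nu>_def by (rule finite_measure.finite_measure_distr[OF _ hN])
  then interpret \<nu>: finite_borel_measure \<nu>
    by (intro finite_borel_measure.intro finite_borel_measure_axioms.intro) (simp_all add: \<nu>_def)
  have \<nu>: "measure \<nu> X = measure V {p \<in> D. h p \<in> X}" if "X \<in> sets borel" for X
  proof -
    have "measure \<nu> X = measure N (h -` X \<inter> D)"
      using that hN by (simp add: \<nu>_def measure_distr) (simp add: N_def space_restrict_space sV)
    also have "h -` X \<inter> D = {p \<in> D. h p \<in> X}" by auto
    finally show ?thesis
      using Db unfolding N_def by (subst (asm) measure_restrict_space) (auto simp: sV)
  qed
  have level: "measure V {p \<in> D. h p = s} = 0" for s
  proof -
    have "{p \<in> D. h p = s} = D \<inter> h -` {s}" by auto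
    also have "\<dots> \<in> sets borel" using Db hb by (auto intro: measurable_sets_borel)
    finally have b: "{p \<in> D. h p = s} \<in> sets borel" .
    have "{p \<in> D. h p = s} \<in> null_sets V"
    proof (rule null_set_of_chart[OF V c b])
      show "{p \<in> D. h p = s} \<subseteq> cdom c" by (auto simp: D_def in_cell)
      show "coord c ` {p \<in> D. h p = s} \<subseteq> {x. x $ i = s}" by (auto simp: D_def h_def)
      have "closed {x::real^'n. x $ i = s}" by (intro closed_Collect_eq continuous_intros)
      then show "{x::real^'n. x $ i = s} \<in> null_sets lborel"
        using negligible_hyperplane[of "axis i (1::real)" s]
        by (intro null_set_lborel) (simp_all add: cart_eq_inner_axis inner_commute axis_eq_0_iff)
    qed
    then show ?thesis by (simp add: measure_def null_setsD1)
  qed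
  have cdf: "cdf \<nu> s = measure V {p \<in> D. h p \<le> s}" for s
    unfolding cdf_def by (subst \<nu>) auto
  have cont: "isCont (cdf \<nu>) s" for s
    unfolding \<nu>.isCont_cdf using level[of s] by (subst \<nu>) auto
  have "cdf \<nu> (l $ i) = 0"
  proof -
    have "{p \<in> D. h p \<le> l $ i} = {p \<in> D. h p = l $ i}"
      by (auto simp: D_def h_def in_cell mem_box_cart intro: antisym)
    then show ?thesis using level by (simp add: cdf)
  qed
  moreover have "cdf \<nu> (r $ i) = measure V D"
  proof -
    have "{p \<in> D. h p \<le> r $ i} = D" by (auto simp: D_def h_def in_cell mem_box_cart)
    then show ?thesis by (simp add: cdf)
  qed
  ultimately have "\<exists>s\<ge>l $ i. s \<le> r $ i \<and> cdf \<nu> s = t * measure V D"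
    using t lr by (intro IVT' continuous_at_imp_continuous_on ballI cont)
      (auto intro: mult_left_le_one_le)
  then obtain s where s: "l $ i \<le> s" "s \<le> r $ i" "measure V {p \<in> D. h p \<le> s} = t * measure V D"
    by (auto simp: cdf)
  \<comment> \<open>The part of the cell below the level \<open>s\<close> is again a cell, hence its frontier is null.\<close>
  define r' where "r' = (\<chi> j. if j = i then s else r $ j)"
  have sub: "x \<in> cbox l r' \<longleftrightarrow> x \<in> cbox l r \<and> x $ i \<le> s" for x
  proof -
    have "x $ j \<le> r' $ j \<longleftrightarrow> x $ j \<le> r $ j \<and> (j = i \<longrightarrow> x $ i \<le> s)" for j
      using s(2) by (auto simp: r'_def)
    then show ?thesis by (auto simp: mem_box_cart)
  qed
  have cc': "chart_cell c l r'"
    using chart box_in_chart by unfold_locales (auto simp: sub)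
  interpret C': chart_cell c l r' by (rule cc')
  have E: "J \<inter> cell c l r' = {p \<in> D. h p \<le> s}"
    by (auto simp: D_def h_def in_cell C'.in_cell sub)
  show ?thesis
  proof (intro exI[of _ "J \<inter> cell c l r'"] conjI)
    show "J \<inter> cell c l r' \<subseteq> J \<inter> cell c l r" by (auto simp: in_cell C'.in_cell sub)
    show "J \<inter> cell c l r' \<in> sets borel" using J C'.cell_closed by auto
    show "frontier (J \<inter> cell c l r') \<in> null_sets V"
      by (intro null_frontier_Int[OF bV] J frontier_cell_null[OF V c cc'])
    show "measure V (J \<inter> cell c l r') = t * measure V (J \<inter> cell c l r)"
      using s(3) E by (simp add: D_def)
  qed
qed

lemma small_cell_exists:
  fixes \<A> :: "('m::{t2_space, second_countable_topology}, 'n::finite) chart set"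
  assumes \<A>: "smooth_structure \<A>" and U: "open U" "p \<in> U"
  shows "\<exists>c\<in>\<A>. \<exists>l r. chart_cell c l r \<and> p \<in> open_cell c l r \<and> cell c l r \<subseteq> U"
proof -
  obtain c where c: "c \<in> \<A>" "p \<in> cdom c"
    using \<A> unfolding smooth_structure_def by blast
  have ch: "is_chart c" using \<A> c unfolding smooth_structure_def by blast
  then have hom: "homeomorphism (cdom c) (coord c ` cdom c) (coord c) (param c)"
    and "open (coord c ` cdom c)"
    unfolding is_chart_def by blast+
  note h = this(2) homeomorphism_cont2[OF hom] homeomorphism_apply1[OF hom]
  have "open (coord c ` cdom c \<inter> param c -` U)"
    by (rule continuous_open_preimage[OF h(2,1) U(1)])
  moreover have "coord c p \<in> coord c ` cdom c \<inter> param c -` U" using c U h(3) by auto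
  ultimately obtain l r where lr: "cbox l r \<subseteq> coord c ` cdom c \<inter> param c -` U" "coord c p \<in> box l r"
    using open_contains_cbox by metis
  then have cc: "chart_cell c l r" using ch by unfold_locales auto
  have "cell c l r \<subseteq> U" using lr by (auto simp: cell_def)
  moreover have "p \<in> open_cell c l r"
    using chart_cell.in_open_cell[OF cc] c lr by auto
  ultimately show ?thesis using c(1) cc by blast
qed

text \<open>Countably many cells form a basis: one cell is picked between each pair of members of a
  countable basis of the topology, whenever there is one.\<close>

lemma countable_cell_basis:
  fixes \<A> :: "('m::{t2_space, second_countable_topology}, 'n::finite) chart set"
  assumes \<A>: "smooth_structure \<A>" and \<Omega>: "open \<Omega>" "\<Omega> \<noteq> {}"
  obtains c l r where "\<And>i::nat. c i \<in> \<A>" "\<And>i. chart_cell (c i) (l i) (r i)"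
    "\<And>i. cell (c i) (l i) (r i) \<subseteq> \<Omega>"
    "\<And>U p. open U \<Longrightarrow> U \<subseteq> \<Omega> \<Longrightarrow> p \<in> U \<Longrightarrow>
       \<exists>i. p \<in> open_cell (c i) (l i) (r i) \<and> cell (c i) (l i) (r i) \<subseteq> U"
proof -
  obtain \<B> :: "'m set set" where \<B>: "countable \<B>" "topological_basis \<B>"
    using ex_countable_basis by blast
  define P where "P A B z \<longleftrightarrow> (case z of (c, l, r) \<Rightarrow> c \<in> \<A> \<and> chart_cell c l r \<and>
      cell c l r \<subseteq> \<Omega> \<and> A \<subseteq> open_cell c l r \<and> cell c l r \<subseteq> B)" for A B z
  define I where "I = {(A, B) \<in> \<B> \<times> \<B>. \<exists>z. P A B z}"
  define K where "K = (\<lambda>(A, B). SOME z. P A B z) ` I"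
  have PI: "P A B (SOME z. P A B z)" if "(A, B) \<in> I" for A B
    using that by (auto simp: I_def intro: someI)
  have "countable I" using \<B>(1) by (intro countable_subset[of I "\<B> \<times> \<B>"]) (auto simp: I_def)
  then have Kc: "countable K" by (simp add: K_def)
  have basis: "\<exists>c l r. (c, l, r) \<in> K \<and> p \<in> open_cell c l r \<and> cell c l r \<subseteq> U"
    if U: "open U" "U \<subseteq> \<Omega>" "p \<in> U" for U p
  proof -
    obtain B where B: "B \<in> \<B>" "p \<in> B" "B \<subseteq> U" using topological_basisE[OF \<B>(2) U(1,3)] .
    have "open B" using topological_basis_open[OF \<B>(2) B(1)] .
    then obtain c l r where c: "c \<in> \<A>" "chart_cell c l r" "p \<in> open_cell c l r" "cell c l r \<subseteq> B"
      using small_cell_exists[OF \<A> _ B(2)] by blast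
    obtain A where A: "A \<in> \<B>" "p \<in> A" "A \<subseteq> open_cell c l r"
      using topological_basisE[OF \<B>(2) chart_cell.open_cell_open[OF c(2)] c(3)] .
    have "P A B (c, l, r)" using c A B U by (auto simp: P_def)
    then have AB: "(A, B) \<in> I" using A B unfolding I_def by blast
    obtain c' l' r' where z: "(SOME z. P A B z) = (c', l', r')" by (metis prod_cases3)
    have "(c', l', r') \<in> K" using AB z unfolding K_def by force
    moreover have "P A B (c', l', r')" using PI[OF AB] z by simp
    moreover have "p \<in> open_cell c' l' r'" "cell c' l' r' \<subseteq> U"
      using calculation(2) A(2) B(3) by (auto simp: P_def)
    ultimately show ?thesis by blast
  qed
  have Kne: "K \<noteq> {}" using basis[OF \<Omega>(1) order_refl] \<Omega>(2) by blast
  define F where "F = from_nat_into K"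
  have F: "range F = K" unfolding F_def by (rule range_from_nat_into[OF Kne Kc])
  have FK: "c \<in> \<A> \<and> chart_cell c l r \<and> cell c l r \<subseteq> \<Omega>" if clr: "(c, l, r) \<in> K" for c l r
  proof -
    obtain A B where "(A, B) \<in> I" "(c, l, r) = (SOME z. P A B z)" using clr unfolding K_def by fast
    then have "P A B (c, l, r)" using PI by metis
    then show ?thesis by (simp add: P_def)
  qed
  let ?c = "\<lambda>i. fst (F i)" and ?l = "\<lambda>i. fst (snd (F i))" and ?r = "\<lambda>i. snd (snd (F i))"
  have FF: "(?c i, ?l i, ?r i) \<in> K" for i using F by auto
  show thesis
  proof (rule that[of ?c ?l ?r])
    show "\<exists>i. p \<in> open_cell (?c i) (?l i) (?r i) \<and> cell (?c i) (?l i) (?r i) \<subseteq> U"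
      if "open U" "U \<subseteq> \<Omega>" "p \<in> U" for U p
    proof -
      obtain c l r where z: "(c, l, r) \<in> K" "p \<in> open_cell c l r" "cell c l r \<subseteq> U"
        using basis[OF \<open>open U\<close> \<open>U \<subseteq> \<Omega>\<close> \<open>p \<in> U\<close>] by blast
      then obtain i where "F i = (c, l, r)" using F by (metis imageE)
      then show ?thesis using z by (intro exI[of _ i]) simp
    qed
  qed (use FK[OF FF] in auto)
qed

lemma jordan_cells_exist:
  fixes \<A> :: "('m::{t2_space, second_countable_topology}, 'n::finite) chart set"
  assumes \<A>: "smooth_structure \<A>" and V: "riemannian_volume \<A> g V"
    and \<Omega>: "open \<Omega>" "\<Omega> \<noteq> {}" "emeasure V \<Omega> < \<infinity>"
  obtains C b where "jordan_cells V \<Omega> C b"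
proof -
  obtain B where B: "sets B = sets borel" "V = completion B"
    using V unfolding riemannian_volume_def by blast
  have bV: "sets borel \<subseteq> sets V"
    using B by auto
  obtain c l r where c: "\<And>i::nat. c i \<in> \<A>" "\<And>i. chart_cell (c i) (l i) (r i)"
    "\<And>i. cell (c i) (l i) (r i) \<subseteq> \<Omega>"
    "\<And>U p. open U \<Longrightarrow> U \<subseteq> \<Omega> \<Longrightarrow> p \<in> U \<Longrightarrow>
       \<exists>i. p \<in> open_cell (c i) (l i) (r i) \<and> cell (c i) (l i) (r i) \<subseteq> U"
    using countable_cell_basis[OF \<A> \<Omega>(1,2)] by blast
  have fin: "emeasure V (cell (c i) (l i) (r i)) < \<infinity>" for i
    using emeasure_mono[OF c(3), of V i] \<Omega>(3) subsetD[OF bV borel_open[OF \<Omega>(1)]] by (auto intro: le_less_trans)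
  have "jordan_cells V \<Omega> (\<lambda>i. cell (c i) (l i) (r i)) (\<lambda>i. bump (c i) (l i) (r i))"
  proof
    show "sets borel \<subseteq> sets V" by (rule bV)
    show "\<exists>E'\<in>sets borel. AE x in V. x \<in> E \<longleftrightarrow> x \<in> E'" if E: "E \<in> sets V" for E
    proof -
      obtain S N N' where S: "E = S \<union> N" "N \<subseteq> N'" "N' \<in> null_sets B" "S \<in> sets B"
        using E unfolding B(2) by (rule sets_completionE)
      have "AE x in B. x \<notin> N'" by (rule AE_not_in[OF S(3)])
      then have "AE x in B. x \<in> E \<longleftrightarrow> x \<in> S"
        by eventually_elim (use S in auto)
      then show ?thesis unfolding B(2) using S(4) B(1) AE_completion by blast
    qed
    show "open \<Omega>" "emeasure V \<Omega> < \<infinity>" by fact+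
    fix i
    interpret chart_cell "c i" "l i" "r i" by (rule c)
    show "compact (cell (c i) (l i) (r i))" by (rule cell_compact)
    show "closed (cell (c i) (l i) (r i))" by (rule cell_closed)
    show "cell (c i) (l i) (r i) \<subseteq> \<Omega>" by (rule c)
    show "frontier (cell (c i) (l i) (r i)) \<in> null_sets V"
      by (rule frontier_cell_null[OF V c(1,2)])
    show "continuous_on UNIV (bump (c i) (l i) (r i))" by (rule bump_continuous)
    show "0 \<le> bump (c i) (l i) (r i) p" for p by (simp add: bump_def infdist_nonneg)
    show "p \<notin> cell (c i) (l i) (r i) \<Longrightarrow> bump (c i) (l i) (r i) p = 0" for p
      by (simp add: bump_def)
    show "\<exists>E\<subseteq>J \<inter> cell (c i) (l i) (r i). E \<in> sets borel \<and> frontier E \<in> null_sets V \<and>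
        measure V E = t * measure V (J \<inter> cell (c i) (l i) (r i))"
      if "J \<in> sets borel" "frontier J \<in> null_sets V" "0 \<le> t" "t \<le> 1" for J t
      by (rule cell_splits[OF V c(1,2) bV fin that])
  next
    show "\<exists>i. 0 < bump (c i) (l i) (r i) p \<and> cell (c i) (l i) (r i) \<subseteq> U"
      if "open U" "U \<subseteq> \<Omega>" "p \<in> U" for U p
      using c(4)[OF that] chart_cell.bump_pos[OF c(2)] by blast
  qed
  then show thesis by (rule that)
qed

section \<open>The supremum\<close>

lemma (in jordan_cells) set_integral_eq_mass:
  fixes h :: "'m \<Rightarrow> real"
  assumes "E \<subseteq> \<Omega>" shows "(LINT p:E|V. h p) = mass h E"
proof -
  have "mass h E = (LINT p|V. indicator \<Omega> p *\<^sub>R (indicator E p * h p))"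
    using domain_sets by (intro integral_restrict_space) (simp add: space_V)
  also have "\<dots> = (LINT p:E|V. h p)"
    unfolding set_lebesgue_integral_def using assms
    by (intro Bochner_Integration.integral_cong) (auto simp: indicator_def)
  finally show ?thesis by simp
qed

lemma (in jordan_cells) QUE_vague_limit:
  assumes que: "QUE_on_base V \<Omega> \<phi>" and meas: "\<And>k. \<phi> (Suc k) \<in> borel_measurable M"
    and pos: "0 < measure M \<Omega>"
    and f: "continuous_on UNIV f" "compact K" "K \<subseteq> \<Omega>" "\<And>p. p \<notin> K \<Longrightarrow> f p = 0"
  shows "(\<lambda>k. LINT x|M. f x * (\<phi> (Suc k) x)\<^sup>2) \<longlonglongrightarrow> 1 / measure M \<Omega> * (LINT x|M. f x)"
proof -
  have fm: "f \<in> borel_measurable M" by (rule continuous_measurable_M[OF f(1)])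
  have "(\<lambda>j. LINT p|density M (\<lambda>p. ennreal ((\<phi> j p)\<^sup>2)). f p) \<longlonglongrightarrow> (LINT p|uniform_measure M \<Omega>. f p)"
    using que f unfolding QUE_on_base_def vaguely_converges_on_def by blast
  then have "(\<lambda>k. LINT p|density M (\<lambda>p. ennreal ((\<phi> (Suc k) p)\<^sup>2)). f p) \<longlonglongrightarrow> (LINT p|uniform_measure M \<Omega>. f p)"
    by (rule LIMSEQ_Suc)
  also have "(\<lambda>k. LINT p|density M (\<lambda>p. ennreal ((\<phi> (Suc k) p)\<^sup>2)). f p) =
      (\<lambda>k. LINT x|M. f x * (\<phi> (Suc k) x)\<^sup>2)"
    using meas fm by (intro ext) (subst integral_density; auto simp: mult.commute)
  also have "uniform_measure M \<Omega> = density M (\<lambda>x. ennreal (indicator \<Omega> x / measure M \<Omega>))"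
    unfolding uniform_measure_def emeasure_eq_measure
    using pos by (intro density_cong arg_cong[where f = "density M"] ext)
      (auto simp: indicator_def divide_ennreal[symmetric])
  also have "(LINT p|density M (\<lambda>x. ennreal (indicator \<Omega> x / measure M \<Omega>)). f p) =
      (LINT p|M. 1 / measure M \<Omega> * f p)"
  proof (subst integral_density)
    show "(\<lambda>x. indicator \<Omega> x / measure M \<Omega>) \<in> borel_measurable M"
      using domain_sets by (intro borel_measurable_divide borel_measurable_indicator) (simp_all add: sets_M)
    show "(LINT x|M. (indicator \<Omega> x / measure M \<Omega>) *\<^sub>R f x) = (LINT p|M. 1 / measure M \<Omega> * f p)"
      by (rule Bochner_Integration.integral_cong) auto
  qed (use fm in auto)
  finally show ?thesis by simp
qed

theorem theorem5:
  fixes \<A> :: "('m::{t2_space, second_countable_topology}, 'n::finite) chart set"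
    and g :: "('m, 'n) metric"
    and V \<sigma> :: "'m measure"
    and \<Omega> :: "'m set"
    and bc :: "'m bdry_cond"
    and \<phi> :: "nat \<Rightarrow> 'm \<Rightarrow> real"
    and lam :: "nat \<Rightarrow> real"
    and L :: real
  assumes "smooth_structure \<A>"
    and "riemannian_metric \<A> g"
    and "riemannian_volume \<A> g V"
    and "open \<Omega>" and "connected \<Omega>" and "\<Omega> \<noteq> {}"
    and "riem_bounded \<A> g \<Omega>" and "emeasure V \<Omega> < \<infinity>"
    and "frontier \<Omega> = {} \<longrightarrow> compact \<Omega>"
    and "frontier \<Omega> \<noteq> {} \<longrightarrow> lipschitz_boundary \<A> \<Omega>"
    and "boundary_measure \<A> g \<Omega> \<sigma>"
    and "admissible_bc \<sigma> \<Omega> bc"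
    and "eigenbasis \<A> g V \<sigma> \<Omega> bc \<phi> lam"
    and "QUE_on_base V \<Omega> \<phi>"
    and "uniformly_Lp_bounded V \<Omega> \<phi>"
    and "0 < L" and "L < 1"
  shows "(SUP \<omega>\<in>U_L_b V \<Omega> L. INF j\<in>{1..}. ereal (LINT p:\<omega>|V. (\<phi> j p)\<^sup>2)) = ereal L"
proof -
  obtain C b where "jordan_cells V \<Omega> C b"
    using jordan_cells_exist[OF assms(1,3,4,6,8)] .
  then interpret jordan_cells V \<Omega> C b .
  \<comment> \<open>The eigenfunctions are numbered from \<open>1\<close>, the sequence \<open>u\<close> from \<open>0\<close>.\<close>
  define u where "u k p = (\<phi> (Suc k) p)\<^sup>2" for k p
  have onb: "orthonormal_basis V \<Omega> bc \<phi>" using assms(13) by (simp add: eigenbasis_def)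
  have "\<forall>j\<ge>1. (\<lambda>p. complex_of_real (\<phi> j p)) \<in> state_space V \<Omega> bc"
    using onb unfolding orthonormal_basis_def by (rule conjunct1)
  then have L2: "L2_fun M (\<lambda>p. complex_of_real (\<phi> (Suc k) p))" for k
    by (simp add: state_space_def)
  have normalized: "(LINT p:\<Omega>|V. \<phi> j p * \<phi> j p) = 1" if "j \<ge> 1" for j
    using conjunct1[OF conjunct2[OF onb[unfolded orthonormal_basis_def]]] that by simp
  have meas: "\<phi> (Suc k) \<in> borel_measurable M" for k
  proof -
    have "(\<lambda>p. Re (complex_of_real (\<phi> (Suc k) p))) \<in> borel_measurable M"
      using L2[of k] unfolding L2_fun_def
      by (elim conjE) (rule measurable_compose[OF _ borel_measurable_Re])
    then show ?thesis by simp
  qed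
  have int: "integrable M (\<lambda>p. (\<phi> (Suc k) p)\<^sup>2)" for k
    using L2[of k] by (simp add: L2_fun_def)
  have one: "(LINT x|M. u k x) = 1" for k
  proof -
    have "mass (u k) \<Omega> = (LINT p:\<Omega>|V. \<phi> (Suc k) p * \<phi> (Suc k) p)"
      unfolding set_integral_eq_mass[OF order_refl] u_def power2_eq_square ..
    also have "\<dots> = 1" by (rule normalized) simp
    finally have "mass (u k) \<Omega> = 1" .
    moreover have "mass (u k) \<Omega> = (LINT x|M. u k x)"
      by (rule Bochner_Integration.integral_cong) auto
    ultimately show ?thesis by simp
  qed
  have ui: "equi_integrable M u"
  proof -
    obtain p A where "p > 1" "\<forall>j\<ge>1. Lp_norm M (2 * p) (\<phi> j) \<le> ennreal A"
      using assms(15) unfolding uniformly_Lp_bounded_def by blast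
    then show ?thesis
      unfolding u_def by (intro equi_integrable_of_Lp_bound[OF finite_M int meas, where p = p and A = A]) auto
  qed
  have \<Omega>M: "\<Omega> \<in> sets M" using domain_sets by (simp add: sets_M)
  have pos: "0 < measure M \<Omega>"
  proof (rule ccontr)
    assume "\<not> ?thesis"
    then have "measure M \<Omega> = 0" by (simp add: measure_nonneg order_antisym not_less)
    then have "\<Omega> \<in> null_sets M" using \<Omega>M by (simp add: null_sets_def emeasure_eq_measure)
    then have "AE x in M. x \<notin> \<Omega>" by (rule AE_not_in)
    then have "AE x in M. u 0 x = 0" using AE_space[of M] by eventually_elim auto
    then have "(LINT x|M. u 0 x) = 0" by (rule integral_eq_zero_AE)
    with one show False by simp
  qed
  have conv: "(\<lambda>k. mass (u k) E) \<longlonglongrightarrow> 1 / measure M \<Omega> * measure M E" if "E \<in> sets M" for E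
  proof (rule weak_limit_of_vague_limit[OF ui _ that])
    fix f :: "'m \<Rightarrow> real" and K
    assume "continuous_on UNIV f" "compact K" "K \<subseteq> \<Omega>" "\<And>p. p \<notin> K \<Longrightarrow> f p = 0"
    then show "(\<lambda>k. LINT x|M. f x * u k x) \<longlonglongrightarrow> 1 / measure M \<Omega> * (LINT x|M. f x)"
      unfolding u_def by (rule QUE_vague_limit[OF assms(14) meas pos])
  qed
  have vol: "emeasure V E = ennreal L * emeasure V \<Omega> \<longleftrightarrow> measure M E = L * measure M \<Omega>"
    if "E \<in> sets M" for E
  proof -
    have "emeasure V D = ennreal (measure M D)" if "D \<in> sets M" for D
      using that sets_M[of D] domain_sets
      by (subst emeasure_eq_measure[symmetric], subst emeasure_restrict_space) (auto simp: space_V)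
    then show ?thesis
      using that \<Omega>M assms(16) by (simp add: ennreal_mult[symmetric])
  qed
  have upper: "(INF j\<in>{1..}. ereal (LINT p:\<omega>|V. (\<phi> j p)\<^sup>2)) \<le> ereal L"
    if \<omega>: "\<omega> \<in> U_L_b V \<Omega> L" for \<omega>
  proof (rule LIMSEQ_le_const)
    have s: "\<omega> \<subseteq> \<Omega>" "\<omega> \<in> sets M" using \<omega> by (auto simp: U_L_b_def sets_M)
    have "measure M \<omega> = L * measure M \<Omega>" using \<omega> vol[OF s(2)] by (auto simp: U_L_b_def)
    then show "(\<lambda>k. ereal (mass (u k) \<omega>)) \<longlonglongrightarrow> ereal L"
      using conv[OF s(2)] pos by simp
    show "\<exists>N. \<forall>k\<ge>N. (INF j\<in>{1..}. ereal (LINT p:\<omega>|V. (\<phi> j p)\<^sup>2)) \<le> ereal (mass (u k) \<omega>)"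
      unfolding u_def set_integral_eq_mass[OF s(1)] by (auto intro: INF_lower)
  qed
  have lower: "ereal L \<le> (SUP \<omega>\<in>U_L_b V \<Omega> L. INF j\<in>{1..}. ereal (LINT p:\<omega>|V. (\<phi> j p)\<^sup>2)) + ereal \<epsilon>"
    if \<epsilon>: "\<epsilon> > 0" for \<epsilon>
  proof -
    obtain E where E: "jordan E" "measure M E = L * measure M \<Omega>" "\<And>k. L - \<epsilon> \<le> mass (u k) E"
      using exists_uniform_set[OF ui conv one pos assms(16,17) \<epsilon>] by blast
    have "E \<in> U_L_b V \<Omega> L"
      using E(1,2) vol[OF jordan_sets[OF E(1)]] jordan_subset[OF E(1)] borel_subset
      by (auto simp: U_L_b_def jordan_def)
    moreover have "ereal (L - \<epsilon>) \<le> (INF j\<in>{1..}. ereal (LINT p:E|V. (\<phi> j p)\<^sup>2))"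
    proof (rule INF_greatest)
      fix j :: nat assume "j \<in> {1..}"
      then obtain k where "j = Suc k" by (cases j) auto
      then show "ereal (L - \<epsilon>) \<le> ereal (LINT p:E|V. (\<phi> j p)\<^sup>2)"
        using E(3)[of k] by (simp add: set_integral_eq_mass[OF jordan_subset[OF E(1)]] u_def)
    qed
    ultimately have "ereal (L - \<epsilon>) \<le> (SUP \<omega>\<in>U_L_b V \<Omega> L. INF j\<in>{1..}. ereal (LINT p:\<omega>|V. (\<phi> j p)\<^sup>2))"
      by (rule SUP_upper2)
    then have "ereal (L - \<epsilon>) + ereal \<epsilon> \<le> (SUP \<omega>\<in>U_L_b V \<Omega> L. INF j\<in>{1..}. ereal (LINT p:\<omega>|V. (\<phi> j p)\<^sup>2)) + ereal \<epsilon>"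
      by (rule add_right_mono)
    then show ?thesis by simp
  qed
  show ?thesis
  proof (rule antisym)
    show "(SUP \<omega>\<in>U_L_b V \<Omega> L. INF j\<in>{1..}. ereal (LINT p:\<omega>|V. (\<phi> j p)\<^sup>2)) \<le> ereal L"
      by (rule SUP_least) (rule upper)
    show "ereal L \<le> (SUP \<omega>\<in>U_L_b V \<Omega> L. INF j\<in>{1..}. ereal (LINT p:\<omega>|V. (\<phi> j p)\<^sup>2))"
      by (rule ereal_le_epsilon2) (use lower in blast)
  qed
qed

end
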